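(* Let $G=(V,E,L)$ be a graph with loops. If $G$ does not have any connected-plus-triplets, then $\mathrm{QP}(G)$ admits an SDP-representable formulation with $O(2^{|V|})$ variables and inequalities.
   Context: A graph with loops $G=(V,E,L)$ has a finite node set $V$, an edge set $E$ of unordered pairs $\{i,j\}$ of distinct nodes, and a set $L$ of loops $\{i,i\}$, $i\in V$, partitioned as $L=L^+\cup L^-$ into plus loops ($L^+$) and minus loops ($L^-$). Define $$\mathrm{QP}(G):=\mathrm{conv}\{z\in\mathbb{R}^{V\cup E\cup L}: z_{ii}\ge z_i^2\ \forall\{i,i\}\in L^+,\ z_{ii}\le z_i^2\ \forall\{i,i\}\in L^-,\ z_{ij}=z_iz_j\ \forall\{i,j\}\in E,\ z_i\in[0,1]\ \forall i\in V\}.$$ Let $V^+:=\{i\in V:\{i,i\}\in L^+\}$, let $G_{V^+}$ be the subgraph of $G$ induced by $V^+$, and let $V_c$, $c\in\mathcal{C}$, be (the node sets of) the connected components of $G_{V^+}$. One says that $G$ does not have any connected-plus-triplets if $|V_c|\le 2$ for all $c\in\mathcal{C}$. A set is SDP-representable if it is the projection of a higher-dimensional set defined by linear matrix inequalities (LMIs); an SDP-representable formulation of $\mathrm{QP}(G)$ is a system of LMIs (including linear inequalities), possibly in additional variables, whose solution set projects onto $\mathrm{QP}(G)$. "Inequalities" counts linear inequalities and LMIs. *)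

theory Defs
  imports
    "HOL-Analysis.Analysis"
    "HOL-Analysis.Finite_Function_Topology"
    "HOL-Library.Landau_Symbols"
    "Jordan_Normal_Form.Matrix"
begin

text \<open>
  An edge is an unordered pair \<open>{i, j}\<close> with \<open>i \<noteq> j\<close>; a loop is \<open>{i, i}\<close>, which is the same set
  as \<open>{i}\<close>.
\<close>

record 'a loop_graph =
  nodes :: "'a set"
  edges :: "'a set set"
  plus_loops :: "'a set set"
  minus_loops :: "'a set set"

definition loops :: "'a loop_graph \<Rightarrow> 'a set set" where
  "loops G = plus_loops G \<union> minus_loops G"

definition is_loop_graph :: "'a loop_graph \<Rightarrow> bool" where
  "is_loop_graph G \<longleftrightarrow>
     finite (nodes G) \<and>
     edges G \<subseteq> {{i, j} | i j. i \<in> nodes G \<and> j \<in> nodes G \<and> i \<noteq> j} \<and>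
     loops G \<subseteq> {{i, i} | i. i \<in> nodes G} \<and>
     plus_loops G \<inter> minus_loops G = {}"

definition plus_nodes :: "'a loop_graph \<Rightarrow> 'a set" where
  "plus_nodes G = {i \<in> nodes G. {i, i} \<in> plus_loops G}"

definition induced_adj :: "'a loop_graph \<Rightarrow> 'a set \<Rightarrow> ('a \<times> 'a) set" where
  "induced_adj G W = {(i, j). i \<in> W \<and> j \<in> W \<and> i \<noteq> j \<and> {i, j} \<in> edges G}"

definition induced_components :: "'a loop_graph \<Rightarrow> 'a set \<Rightarrow> 'a set set" where
  "induced_components G W = W // {(i, j) \<in> W \<times> W. (i, j) \<in> (induced_adj G W)\<^sup>*}"

definition no_connected_plus_triplets :: "'a loop_graph \<Rightarrow> bool" where
  "no_connected_plus_triplets G \<longleftrightarrow>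
     (\<forall>W \<in> induced_components G (plus_nodes G). card W \<le> 2)"

datatype 'a coord = Node 'a | Quad "'a set"

definition coords :: "'a loop_graph \<Rightarrow> 'a coord set" where
  "coords G = Node ` nodes G \<union> Quad ` (edges G \<union> loops G)"

text \<open>
  For a finite set \<open>K\<close>, the space of real vectors indexed by \<open>K\<close> is represented by the finitely
  supported functions that vanish outside \<open>K\<close>.
\<close>

definition vectors_on :: "'k set \<Rightarrow> ('k \<Rightarrow>\<^sub>0 real) set" where
  "vectors_on K = {z. Poly_Mapping.keys z \<subseteq> K}"

definition QP :: "'a loop_graph \<Rightarrow> ('a coord \<Rightarrow>\<^sub>0 real) set" where
  "QP G = convex hull
     {z \<in> vectors_on (coords G).
        (\<forall>i. {i, i} \<in> plus_loops G \<longrightarrow>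
           Poly_Mapping.lookup z (Quad {i, i}) \<ge> (Poly_Mapping.lookup z (Node i))\<^sup>2) \<and>
        (\<forall>i. {i, i} \<in> minus_loops G \<longrightarrow>
           Poly_Mapping.lookup z (Quad {i, i}) \<le> (Poly_Mapping.lookup z (Node i))\<^sup>2) \<and>
        (\<forall>i j. {i, j} \<in> edges G \<longrightarrow>
           Poly_Mapping.lookup z (Quad {i, j}) =
           Poly_Mapping.lookup z (Node i) * Poly_Mapping.lookup z (Node j)) \<and>
        (\<forall>i \<in> nodes G. Poly_Mapping.lookup z (Node i) \<in> {0..1})}"

definition symmetric_psd :: "real mat \<Rightarrow> bool" where
  "symmetric_psd A \<longleftrightarrow>
     square_mat A \<and> transpose_mat A = A \<and>
     (\<forall>v \<in> carrier_vec (dim_row A). v \<bullet> (A *\<^sub>v v) \<ge> 0)"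

text \<open>
  With constant term \<open>B\<close>, coefficients \<open>A\<^sub>k\<close> and size \<open>n\<close>, a linear matrix inequality in the
  variables \<open>x\<^sub>k\<close>, \<open>k \<in> X\<close>, says that the \<open>n \<times> n\<close> matrix \<open>B + (\<Sum>k\<in>X. x\<^sub>k A\<^sub>k)\<close> is positive
  semidefinite.
\<close>

record 'k lmi =
  lmi_size :: nat
  lmi_const :: "real mat"
  lmi_coeff :: "'k \<Rightarrow> real mat"

definition is_lmi :: "'k set \<Rightarrow> 'k lmi \<Rightarrow> bool" where
  "is_lmi X M \<longleftrightarrow>
     (\<forall>A \<in> insert (lmi_const M) (lmi_coeff M ` X).
        A \<in> carrier_mat (lmi_size M) (lmi_size M) \<and> transpose_mat A = A)"

definition lmi_matrix :: "'k set \<Rightarrow> 'k lmi \<Rightarrow> ('k \<Rightarrow> real) \<Rightarrow> real mat" where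
  "lmi_matrix X M x =
     mat (lmi_size M) (lmi_size M)
       (\<lambda>(i, j). lmi_const M $$ (i, j) + (\<Sum>k\<in>X. x k * lmi_coeff M k $$ (i, j)))"

definition lmi_holds :: "'k set \<Rightarrow> 'k lmi \<Rightarrow> ('k \<Rightarrow> real) \<Rightarrow> bool" where
  "lmi_holds X M x \<longleftrightarrow> symmetric_psd (lmi_matrix X M x)"

text \<open>The linear inequality \<open>(\<Sum>k\<in>X. a\<^sub>k x\<^sub>k) \<le> b\<close> is given by the pair \<open>(a, b)\<close>.\<close>

type_synonym 'k lin_ineq = "('k \<Rightarrow> real) \<times> real"

definition lin_ineq_holds :: "'k set \<Rightarrow> 'k lin_ineq \<Rightarrow> ('k \<Rightarrow> real) \<Rightarrow> bool" where
  "lin_ineq_holds X c x \<longleftrightarrow> (\<Sum>k\<in>X. fst c k * x k) \<le> snd c"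

text \<open>
  The variables of a system over the original index set \<open>K\<close> are \<open>Inl k\<close> for \<open>k \<in> K\<close> and the
  additional variables \<open>Inr 0, \<dots>, Inr (m - 1)\<close>, where \<open>m\<close> is the value of \<open>num_aux\<close>.
\<close>

record 'k sdp_system =
  num_aux :: nat
  lin_ineqs :: "('k + nat) lin_ineq list"
  lmis :: "('k + nat) lmi list"

definition sdp_vars :: "'k set \<Rightarrow> 'k sdp_system \<Rightarrow> ('k + nat) set" where
  "sdp_vars K F = Inl ` K \<union> Inr ` {..<num_aux F}"

definition sdp_solution :: "'k set \<Rightarrow> 'k sdp_system \<Rightarrow> ('k + nat \<Rightarrow> real) \<Rightarrow> bool" where
  "sdp_solution K F x \<longleftrightarrow>
     (\<forall>c \<in> set (lin_ineqs F). lin_ineq_holds (sdp_vars K F) c x) \<and>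
     (\<forall>M \<in> set (lmis F). lmi_holds (sdp_vars K F) M x)"

definition sdp_projection :: "'k set \<Rightarrow> 'k sdp_system \<Rightarrow> ('k \<Rightarrow>\<^sub>0 real) set" where
  "sdp_projection K F =
     {z \<in> vectors_on K. \<exists>y. sdp_solution K F (case_sum (Poly_Mapping.lookup z) y)}"

definition sdp_formulation :: "'k set \<Rightarrow> 'k sdp_system \<Rightarrow> ('k \<Rightarrow>\<^sub>0 real) set \<Rightarrow> bool" where
  "sdp_formulation K F S \<longleftrightarrow>
     (\<forall>M \<in> set (lmis F). is_lmi (sdp_vars K F) M) \<and> sdp_projection K F = S"

definition num_variables :: "'k set \<Rightarrow> 'k sdp_system \<Rightarrow> nat" where
  "num_variables K F = card (sdp_vars K F)"

definition num_inequalities :: "'k sdp_system \<Rightarrow> nat" where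
  "num_inequalities F = length (lin_ineqs F) + length (lmis F)"

end

theory Submission
  imports Defs
begin

text \<open>
  Every edge coordinate is affine in the value of a node outside \<open>V\<^sup>+\<close>, and by convexity of the square
  the constraint \<open>z\<^sub>i\<^sub>i \<le> z\<^sub>i\<^sup>2\<close> only relaxes when that value is replaced by a mixture of 0 and 1;
  so such nodes may be restricted to the values 0 and 1.
  A point of \<open>QP(G)\<close> is therefore a mixture, over the sets \<open>S\<close> of nodes outside \<open>V\<^sup>+\<close> with value 1,
  of distributions on the unit cube indexed by \<open>V\<^sup>+\<close>. The lifted variables are the mass of each \<open>S\<close> and its
  unnormalised first and second moments on \<open>V\<^sup>+\<close>, constrained by positive semidefiniteness of the
  moment matrix, by \<open>W\<^sub>i\<^sub>i \<le> x\<^sub>i\<close>, and by the McCormick inequalities on the edges inside \<open>V\<^sup>+\<close>.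
  For each \<open>S\<close> there are at most \<open>3 * 2 ^ p\<close> of them, where
  \<open>p\<close> is the size of \<open>V\<^sup>+\<close>, hence at most \<open>3 * 2 ^ card V\<close> in total.

  Conversely, without connected-plus-triplets the edges inside \<open>V\<^sup>+\<close> form a matching. On each such edge
  the prescribed means and covariance are realised by a two-point distribution on \<open>[0,1]\<^sup>2\<close> whose
  variances do not exceed the prescribed ones; the product of these distributions over the matching
  has the required moments, since no coordinate involves two matching edges.
\<close>

section \<open>Systems with linear functionals as data\<close>

text \<open>The coefficient of \<open>k\<close> is read off as the value at the unit vector of
  \<open>k\<close>. A functional can thus be given by a formula, without a coefficient list, and it
  depends only on the values on \<open>X\<close>.\<close>

definition linear_on :: "'v set \<Rightarrow> (('v \<Rightarrow> real) \<Rightarrow> real) \<Rightarrow> bool" where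
  "linear_on X f \<longleftrightarrow> (\<forall>w. f w = (\<Sum>k\<in>X. f (\<lambda>l. of_bool (l = k)) * w k))"

lemma linear_onD: "linear_on X f \<Longrightarrow> f w = (\<Sum>k\<in>X. f (\<lambda>l. of_bool (l = k)) * w k)"
  unfolding linear_on_def by (erule allE)

lemma linear_onI:
  assumes "finite X" "\<And>w. f w = (\<Sum>k\<in>X. a k * w k)"
  shows "linear_on X f"
  unfolding linear_on_def
proof
  fix w
  have "f (\<lambda>l. of_bool (l = k)) = a k" if "k \<in> X" for k
    using assms(1) that unfolding assms(2)
    by (simp add: of_bool_def sum.delta if_distrib cong: if_cong)
  then show "f w = (\<Sum>k\<in>X. f (\<lambda>l. of_bool (l = k)) * w k)"
    by (subst assms(2)) (auto intro: sum.cong)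
qed

lemma linear_on_var: "finite X \<Longrightarrow> k \<in> X \<Longrightarrow> linear_on X (\<lambda>w. w k)"
  by (rule linear_onI[where a = "\<lambda>l. of_bool (l = k)"]) (simp_all add: of_bool_def if_distribR if_distrib[of "\<lambda>x. x * _"] cong: if_cong)

lemma linear_on_zero: "linear_on X (\<lambda>w. 0)"
  by (simp add: linear_on_def)

lemma linear_on_add:
  assumes "linear_on X f" "linear_on X g"
  shows "linear_on X (\<lambda>w. f w + g w)"
  unfolding linear_on_def distrib_right sum.distrib
  by (intro allI arg_cong2[where f = "(+)"] assms[THEN linear_onD])

lemma linear_on_uminus:
  assumes "linear_on X f"
  shows "linear_on X (\<lambda>w. - f w)"
  unfolding linear_on_def mult_minus_left sum_negf
  by (intro allI arg_cong[where f = uminus] linear_onD[OF assms])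

lemma linear_on_diff: "linear_on X f \<Longrightarrow> linear_on X g \<Longrightarrow> linear_on X (\<lambda>w. f w - g w)"
  using linear_on_add[of X f "\<lambda>w. - g w"] linear_on_uminus[of X g] by simp

lemma linear_on_sum: "(\<And>i. i \<in> I \<Longrightarrow> linear_on X (f i)) \<Longrightarrow> linear_on X (\<lambda>w. \<Sum>i\<in>I. f i w)"
  by (induction I rule: infinite_finite_induct) (auto intro: linear_on_zero linear_on_add)

lemma linear_on_if:
  "(c \<Longrightarrow> linear_on X f) \<Longrightarrow> (\<not> c \<Longrightarrow> linear_on X g) \<Longrightarrow> linear_on X (\<lambda>w. if c then f w else g w)"
  by (cases c) simp_all

lemma linear_on_combine:
  assumes "linear_on X f"
  shows "f (\<lambda>k. a * v k + b * w k) = a * f v + b * f w"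
proof -
  have "f (\<lambda>k. a * v k + b * w k) = (\<Sum>k\<in>X. f (\<lambda>l. of_bool (l = k)) * (a * v k + b * w k))"
    by (rule linear_onD[OF assms])
  also have "\<dots> = a * (\<Sum>k\<in>X. f (\<lambda>l. of_bool (l = k)) * v k) + b * (\<Sum>k\<in>X. f (\<lambda>l. of_bool (l = k)) * w k)"
    by (simp add: algebra_simps sum.distrib sum_distrib_left)
  finally show ?thesis
    unfolding linear_onD[OF assms, symmetric] .
qed

text \<open>Rewrites a functional in renamed variables. It is applied with \<open>Y\<close> the
  numbered variables of an \<open>sdp_system\<close>, so constraints can be stated over any finite
  index set.\<close>

lemma linear_on_reindex:
  assumes "linear_on X f" "bij_betw h Y X" "\<And>k. k \<in> Y \<Longrightarrow> w (h k) = x k"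
  shows "(\<Sum>k\<in>Y. f (\<lambda>l. of_bool (l = h k)) * x k) = f w"
proof -
  have "(\<Sum>k\<in>Y. f (\<lambda>l. of_bool (l = h k)) * x k) = (\<Sum>k\<in>Y. f (\<lambda>l. of_bool (l = h k)) * w (h k))"
    using assms(3) by (intro sum.cong) auto
  also have "\<dots> = (\<Sum>k\<in>X. f (\<lambda>l. of_bool (l = k)) * w k)"
    by (rule sum.reindex_bij_betw[OF assms(2)])
  finally show ?thesis
    by (simp only: linear_onD[OF assms(1), symmetric])
qed

section \<open>Positive semidefiniteness over arbitrary finite index sets\<close>

lemma symmetric_psd_mat_iff:
  assumes "\<And>i j. i < n \<Longrightarrow> j < n \<Longrightarrow> h i j = h j i"
  shows "symmetric_psd (mat n n (\<lambda>(i, j). h i j)) \<longleftrightarrow>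
    (\<forall>v. 0 \<le> (\<Sum>i<n. \<Sum>j<n. v i * v j * h i j))" (is "symmetric_psd ?A \<longleftrightarrow> ?R")
proof -
  have sym: "transpose_mat ?A = ?A"
    using assms by (intro eq_matI) auto
  have form: "scalar_prod v (?A *\<^sub>v v) = (\<Sum>i<n. \<Sum>j<n. v $ i * v $ j * h i j)" if "v \<in> carrier_vec n" for v
    using that unfolding scalar_prod_def
    by (auto simp: scalar_prod_def sum_distrib_left lessThan_atLeast0 algebra_simps intro!: sum.cong)
  have "(\<forall>v\<in>carrier_vec n. 0 \<le> scalar_prod v (?A *\<^sub>v v)) \<longleftrightarrow> ?R"
  proof safe
    fix v :: "nat \<Rightarrow> real"
    assume "\<forall>v\<in>carrier_vec n. 0 \<le> scalar_prod v (?A *\<^sub>v v)"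
    then have "0 \<le> scalar_prod (vec n v) (?A *\<^sub>v vec n v)" by simp
    then show "0 \<le> (\<Sum>i<n. \<Sum>j<n. v i * v j * h i j)" by (simp add: form)
  qed (simp add: form)
  then show ?thesis
    using sym by (simp add: symmetric_psd_def)
qed

text \<open>Rows are indexed by elements of \<open>R\<close> instead of numbers, and test vectors
  are total functions of which only the values on \<open>R\<close> count. Symmetry is kept as a
  separate condition.\<close>

definition psd_on :: "'r set \<Rightarrow> ('r \<Rightarrow> 'r \<Rightarrow> real) \<Rightarrow> bool" where
  "psd_on R h \<longleftrightarrow> (\<forall>v. 0 \<le> (\<Sum>p\<in>R. \<Sum>q\<in>R. v p * v q * h p q))"

lemma psd_on_reindex:
  assumes "bij_betw e A R"
  shows "psd_on A (\<lambda>i j. h (e i) (e j)) \<longleftrightarrow> psd_on R h"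
proof -
  have *: "(\<Sum>i\<in>A. \<Sum>j\<in>A. v (e i) * v (e j) * h (e i) (e j)) = (\<Sum>p\<in>R. \<Sum>q\<in>R. v p * v q * h p q)" for v
    using sum.reindex_bij_betw[OF assms, of "\<lambda>p. \<Sum>j\<in>A. v p * v (e j) * h p (e j)"]
      sum.reindex_bij_betw[OF assms, of "\<lambda>q. v p * v q * h p q" for p]
    by simp
  show ?thesis
  proof
    assume L: "psd_on A (\<lambda>i j. h (e i) (e j))"
    show "psd_on R h" unfolding psd_on_def *[symmetric]
    proof
      fix v
      show "0 \<le> (\<Sum>i\<in>A. \<Sum>j\<in>A. v (e i) * v (e j) * h (e i) (e j))"
        using L unfolding psd_on_def by (rule spec[of _ "\<lambda>i. v (e i)"])
    qed
  next
    assume R: "psd_on R h"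
    show "psd_on A (\<lambda>i j. h (e i) (e j))" unfolding psd_on_def
    proof
      fix v :: "'a \<Rightarrow> real"
      \<comment> \<open>A test vector on \<open>A\<close> is carried to \<open>R\<close> along the
        inverse of \<open>e\<close>.\<close>
      have "inv_into A e (e i) = i" if "i \<in> A" for i
        using assms that by (simp add: bij_betw_def)
      then have "(\<Sum>i\<in>A. \<Sum>j\<in>A. v i * v j * h (e i) (e j)) =
        (\<Sum>i\<in>A. \<Sum>j\<in>A. v (inv_into A e (e i)) * v (inv_into A e (e j)) * h (e i) (e j))"
        by (intro sum.cong) auto
      also have "\<dots> \<ge> 0"
        using R *[of "\<lambda>p. v (inv_into A e p)"] unfolding psd_on_def by auto
      finally show "0 \<le> (\<Sum>i\<in>A. \<Sum>j\<in>A. v i * v j * h (e i) (e j))" .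
    qed
  qed
qed

section \<open>Feasible sets of lifted systems: formulation by LMIs and convexity\<close>

definition feasible_set ::
  "'k set \<Rightarrow> 'i set \<Rightarrow> ('i \<Rightarrow> ('k + 'j \<Rightarrow> real) \<Rightarrow> real) \<Rightarrow> ('i \<Rightarrow> real) \<Rightarrow>
   'n set \<Rightarrow> 'r set \<Rightarrow> ('n \<Rightarrow> 'r \<Rightarrow> 'r \<Rightarrow> ('k + 'j \<Rightarrow> real) \<Rightarrow> real) \<Rightarrow> ('k \<Rightarrow>\<^sub>0 real) set" where
  "feasible_set K I f b N R g = {z \<in> vectors_on K. \<exists>u.
     (\<forall>i\<in>I. f i (case_sum (Poly_Mapping.lookup z) u) \<le> b i) \<and>
     (\<forall>n\<in>N. psd_on R (\<lambda>p q. g n p q (case_sum (Poly_Mapping.lookup z) u)))}"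

text \<open>Numbering \<open>J\<close>, \<open>R\<close>, \<open>I\<close> and \<open>N\<close>
  turns the functionals into lists of inequalities and matrices. The bijection \<open>H\<close>
  matches the two sets of variables, and corresponding assignments satisfy the same
  constraints.\<close>

lemma sdp_formulation_feasible_set:
  fixes f :: "'i \<Rightarrow> ('k + 'j \<Rightarrow> real) \<Rightarrow> real"
    and g :: "'n \<Rightarrow> 'r \<Rightarrow> 'r \<Rightarrow> ('k + 'j \<Rightarrow> real) \<Rightarrow> real"
  assumes fin: "finite K" "finite J" "finite I" "finite N" "finite R"
    and f: "\<And>i. i \<in> I \<Longrightarrow> linear_on (K <+> J) (f i)"
    and g: "\<And>n p q. n \<in> N \<Longrightarrow> p \<in> R \<Longrightarrow> q \<in> R \<Longrightarrow> linear_on (K <+> J) (g n p q)"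
    and sym: "\<And>n p q. n \<in> N \<Longrightarrow> p \<in> R \<Longrightarrow> q \<in> R \<Longrightarrow> g n p q = g n q p"
  shows "\<exists>F. sdp_formulation K F (feasible_set K I f b N R g) \<and>
    num_variables K F = card K + card J \<and> num_inequalities F = card I + card N"
proof -
  obtain h where h: "bij_betw h {..<card J} J"
    using fin(2) by (metis ex_bij_betw_nat_finite lessThan_atLeast0)
  obtain e where e: "bij_betw e {..<card R} R"
    using fin(5) by (metis ex_bij_betw_nat_finite lessThan_atLeast0)
  obtain Is where Is: "set Is = I" "length Is = card I"
    using fin(3) by (metis distinct_card finite_distinct_list)
  obtain Ns where Ns: "set Ns = N" "length Ns = card N"
    using fin(4) by (metis distinct_card finite_distinct_list)
  define H :: "'k + nat \<Rightarrow> 'k + 'j" where "H = map_sum id h"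
  define C where "C i = (\<lambda>k. f i (\<lambda>l. of_bool (l = H k)), b i)" for i
  \<comment> \<open>The entries are homogeneous linear, hence the zero constant term.\<close>
  define M where "M n = \<lparr>lmi_size = card R, lmi_const = 0\<^sub>m (card R) (card R),
    lmi_coeff = (\<lambda>k. mat (card R) (card R) (\<lambda>(i, j). g n (e i) (e j) (\<lambda>l. of_bool (l = H k))))\<rparr>" for n
  define F where "F = \<lparr>num_aux = card J, lin_ineqs = map C Is, lmis = map M Ns\<rparr>"
  have vars: "sdp_vars K F = Inl ` K \<union> Inr ` {..<card J}"
    by (simp add: sdp_vars_def F_def)
  have H: "bij_betw H (sdp_vars K F) (K <+> J)"
    using h unfolding vars H_def bij_betw_def inj_on_def Plus_def
    by (auto simp: image_Un image_image)
  have eR: "e i \<in> R" if "i < card R" for i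
    using e that by (auto simp: bij_betw_def)
  have lmi: "is_lmi (sdp_vars K F) (M n)" if "n \<in> N" for n
    unfolding is_lmi_def M_def using sym[OF that] eR
    by (auto intro!: eq_matI)
  have lin: "lin_ineq_holds (sdp_vars K F) (C i) x \<longleftrightarrow> f i w \<le> b i"
    if "i \<in> I" "\<forall>k\<in>sdp_vars K F. w (H k) = x k" for i x w
    using linear_on_reindex[OF f[OF that(1)] H, of w x] that(2)
    by (simp add: lin_ineq_holds_def C_def)
  have mat: "lmi_holds (sdp_vars K F) (M n) x \<longleftrightarrow> psd_on R (\<lambda>p q. g n p q w)"
    if "n \<in> N" and w: "\<forall>k\<in>sdp_vars K F. w (H k) = x k" for n x w
  proof -
    have "(\<Sum>k\<in>sdp_vars K F. x k * lmi_coeff (M n) k $$ (i, j)) = g n (e i) (e j) w"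
      if ij: "i < card R" "j < card R" for i j
      using linear_on_reindex[OF g[OF \<open>n \<in> N\<close> eR[OF ij(1)] eR[OF ij(2)]] H, of w x] w ij
      by (simp add: M_def mult.commute)
    then have "lmi_matrix (sdp_vars K F) (M n) x = mat (card R) (card R) (\<lambda>(i, j). g n (e i) (e j) w)"
      unfolding lmi_matrix_def by (intro eq_matI) (auto simp: M_def)
    then have "lmi_holds (sdp_vars K F) (M n) x \<longleftrightarrow> psd_on {..<card R} (\<lambda>i j. g n (e i) (e j) w)"
      using sym[OF that(1)] eR by (simp add: lmi_holds_def psd_on_def symmetric_psd_mat_iff)
    then show ?thesis
      using psd_on_reindex[OF e, of "\<lambda>p q. g n p q w"] by simp
  qed
  have sol: "sdp_solution K F x \<longleftrightarrow>
      (\<forall>i\<in>I. f i w \<le> b i) \<and> (\<forall>n\<in>N. psd_on R (\<lambda>p q. g n p q w))"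
    if "\<forall>k\<in>sdp_vars K F. w (H k) = x k" for x w
    using lin[OF _ that] mat[OF _ that] by (simp add: sdp_solution_def F_def Is Ns)
  have "sdp_projection K F = feasible_set K I f b N R g"
  proof (intro subset_antisym subsetI)
    fix z assume "z \<in> sdp_projection K F"
    then obtain y where z: "z \<in> vectors_on K"
      and y: "sdp_solution K F (case_sum (Poly_Mapping.lookup z) y)"
      by (auto simp: sdp_projection_def)
    \<comment> \<open>Values at numbers become values at elements of \<open>J\<close> by inverting
      the numbering.\<close>
    let ?u = "\<lambda>j. y (inv_into {..<card J} h j)"
    have "\<forall>k\<in>sdp_vars K F.
        case_sum (Poly_Mapping.lookup z) ?u (H k) = case_sum (Poly_Mapping.lookup z) y k"
      using bij_betw_inv_into_left[OF h] by (auto simp: vars H_def)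
    from sol[OF this] y have "\<forall>i\<in>I. f i (case_sum (Poly_Mapping.lookup z) ?u) \<le> b i"
      "\<forall>n\<in>N. psd_on R (\<lambda>p q. g n p q (case_sum (Poly_Mapping.lookup z) ?u))"
      by blast+
    with z show "z \<in> feasible_set K I f b N R g"
      unfolding feasible_set_def by blast
  next
    fix z assume "z \<in> feasible_set K I f b N R g"
    then obtain u where z: "z \<in> vectors_on K"
      and u: "\<forall>i\<in>I. f i (case_sum (Poly_Mapping.lookup z) u) \<le> b i"
        "\<forall>n\<in>N. psd_on R (\<lambda>p q. g n p q (case_sum (Poly_Mapping.lookup z) u))"
      unfolding feasible_set_def by blast
    have "\<forall>k\<in>sdp_vars K F.
        case_sum (Poly_Mapping.lookup z) u (H k) = case_sum (Poly_Mapping.lookup z) (u \<circ> h) k"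
      by (auto simp: vars H_def)
    from sol[OF this] u have "sdp_solution K F (case_sum (Poly_Mapping.lookup z) (u \<circ> h))"
      by blast
    with z show "z \<in> sdp_projection K F"
      unfolding sdp_projection_def by blast
  qed
  moreover have "num_variables K F = card K + card J"
    unfolding num_variables_def bij_betw_same_card[OF H] using fin by (simp add: card_Plus)
  moreover have "num_inequalities F = card I + card N"
    by (simp add: num_inequalities_def F_def Is Ns)
  moreover have "\<forall>M \<in> set (lmis F). is_lmi (sdp_vars K F) M"
    using lmi by (auto simp: F_def Ns)
  ultimately show ?thesis
    unfolding sdp_formulation_def by blast
qed

lemma psd_on_combine:
  assumes "psd_on R h" "psd_on R k" "0 \<le> a" "0 \<le> b"
  shows "psd_on R (\<lambda>p q. a * h p q + b * k p q)"
  unfolding psd_on_def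
proof
  fix v :: "'a \<Rightarrow> real"
  have "(\<Sum>p\<in>R. \<Sum>q\<in>R. v p * v q * (a * h p q + b * k p q)) =
    a * (\<Sum>p\<in>R. \<Sum>q\<in>R. v p * v q * h p q) + b * (\<Sum>p\<in>R. \<Sum>q\<in>R. v p * v q * k p q)"
    by (simp add: algebra_simps sum.distrib sum_distrib_left)
  then show "0 \<le> (\<Sum>p\<in>R. \<Sum>q\<in>R. v p * v q * (a * h p q + b * k p q))"
    using assms by (simp add: psd_on_def)
qed

lemma lookup_scaleR: "Poly_Mapping.lookup (r *\<^sub>R x) k = r *\<^sub>R Poly_Mapping.lookup x k"
proof -
  have "finite {k. r *\<^sub>R Poly_Mapping.lookup x k \<noteq> 0}"
    by (rule finite_subset[OF _ finite_lookup[of x]]) auto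
  then show ?thesis
    by (simp add: scaleR_poly_mapping_def)
qed

lemma vectors_on_iff: "z \<in> vectors_on K \<longleftrightarrow> (\<forall>k. k \<notin> K \<longrightarrow> Poly_Mapping.lookup z k = 0)"
  by (auto simp: vectors_on_def in_keys_iff)

lemma convex_vectors_on: "convex (vectors_on K)"
  by (auto intro!: convexI simp: vectors_on_iff lookup_add lookup_scaleR)

text \<open>The auxiliary variables of two feasible points are mixed with the same weights as the
  points. Linear inequalities survive the mixture, and so do the matrix conditions, since the
  positive semidefinite matrices form a convex cone.\<close>

lemma convex_feasible_set:
  fixes f :: "'i \<Rightarrow> ('k + 'j \<Rightarrow> real) \<Rightarrow> real"
  assumes f: "\<And>i. i \<in> I \<Longrightarrow> linear_on X (f i)"
    and g: "\<And>n p q. n \<in> N \<Longrightarrow> p \<in> R \<Longrightarrow> q \<in> R \<Longrightarrow> linear_on X (g n p q)"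
  shows "convex (feasible_set K I f b N R g)"
proof (rule convexI)
  fix x y :: "'k \<Rightarrow>\<^sub>0 real" and s t :: real
  assume "x \<in> feasible_set K I f b N R g" "y \<in> feasible_set K I f b N R g"
    and st: "0 \<le> s" "0 \<le> t" "s + t = 1"
  then obtain u v where x: "x \<in> vectors_on K" and y: "y \<in> vectors_on K"
    and u: "\<And>i. i \<in> I \<Longrightarrow> f i (case_sum (Poly_Mapping.lookup x) u) \<le> b i"
      "\<And>n. n \<in> N \<Longrightarrow> psd_on R (\<lambda>p q. g n p q (case_sum (Poly_Mapping.lookup x) u))"
    and v: "\<And>i. i \<in> I \<Longrightarrow> f i (case_sum (Poly_Mapping.lookup y) v) \<le> b i"
      "\<And>n. n \<in> N \<Longrightarrow> psd_on R (\<lambda>p q. g n p q (case_sum (Poly_Mapping.lookup y) v))"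
    unfolding feasible_set_def by blast
  let ?w = "case_sum (Poly_Mapping.lookup (s *\<^sub>R x + t *\<^sub>R y)) (\<lambda>j. s * u j + t * v j)"
  have w: "?w = (\<lambda>k. s * case_sum (Poly_Mapping.lookup x) u k + t * case_sum (Poly_Mapping.lookup y) v k)"
    by (auto simp: fun_eq_iff lookup_add lookup_scaleR split: sum.split)
  have "f i ?w \<le> b i" if "i \<in> I" for i
  proof -
    have "f i ?w \<le> s * b i + t * b i"
      unfolding w linear_on_combine[OF f[OF that]]
      by (intro add_mono mult_left_mono u v that st)
    then show ?thesis
      using st(3) by (simp add: distrib_right[symmetric])
  qed
  moreover have "psd_on R (\<lambda>p q. g n p q ?w)" if "n \<in> N" for n
  proof -
    have "psd_on R (\<lambda>p q. g n p q ?w) = psd_on R (\<lambda>p q.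
      s * g n p q (case_sum (Poly_Mapping.lookup x) u) + t * g n p q (case_sum (Poly_Mapping.lookup y) v))"
      unfolding w psd_on_def using linear_on_combine[OF g[OF that]] by simp
    then show ?thesis
      using psd_on_combine[OF u(2)[OF that] v(2)[OF that] st(1,2)] by simp
  qed
  moreover have "s *\<^sub>R x + t *\<^sub>R y \<in> vectors_on K"
    using convex_vectors_on x y st by (blast dest: convexD)
  ultimately show "s *\<^sub>R x + t *\<^sub>R y \<in> feasible_set K I f b N R g"
    unfolding feasible_set_def by blast
qed

section \<open>Moments realised by product distributions\<close>

text \<open>For \<open>t\<close> with values in the unit interval, the probability that a random
  subset of \<open>A\<close>, containing each \<open>i\<close> independently with probability
  \<open>t i\<close>, equals \<open>S\<close>.\<close>

definition product_weight :: "('b \<Rightarrow> real) \<Rightarrow> 'b set \<Rightarrow> 'b set \<Rightarrow> real" where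
  "product_weight t A S = (\<Prod>i\<in>S. t i) * (\<Prod>i\<in>A - S. 1 - t i)"

lemma product_weight_nonneg:
  assumes "S \<subseteq> A" "\<And>i. i \<in> A \<Longrightarrow> t i \<in> {0..1}"
  shows "0 \<le> product_weight t A S"
  unfolding product_weight_def using assms by (intro mult_nonneg_nonneg prod_nonneg) auto

text \<open>This is the probability that the random subset contains \<open>B\<close>; it comes from
  expanding a product of two-term sums over \<open>A\<close>.\<close>

lemma sum_product_weight_superset:
  assumes "finite A" "B \<subseteq> A"
  shows "(\<Sum>S\<in>Pow A. if B \<subseteq> S then product_weight t A S else 0) = (\<Prod>i\<in>B. t i)"
proof -
  \<comment> \<open>Setting the second term to 0 on \<open>B\<close> kills every subset that misses
    an element of \<open>B\<close>.\<close>
  let ?g = "\<lambda>i. if i \<in> B then 0 else 1 - t i"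
  have "(\<Prod>i\<in>B. t i) = (\<Prod>i\<in>A. t i + ?g i)"
    using assms by (intro prod.mono_neutral_cong_left) auto
  also have "\<dots> = (\<Sum>S\<in>Pow A. (\<Prod>i\<in>S. t i) * (\<Prod>i\<in>A - S. ?g i))"
    by (rule prod_add[OF assms(1)])
  also have "\<dots> = (\<Sum>S\<in>Pow A. if B \<subseteq> S then product_weight t A S else 0)"
  proof (rule sum.cong)
    fix S assume "S \<in> Pow A"
    show "(\<Prod>i\<in>S. t i) * (\<Prod>i\<in>A - S. ?g i) = (if B \<subseteq> S then product_weight t A S else 0)"
    proof (cases "B \<subseteq> S")
      case True
      then have "(\<Prod>i\<in>A - S. ?g i) = (\<Prod>i\<in>A - S. 1 - t i)"
        by (intro prod.cong) auto
      with True show ?thesis by (simp add: product_weight_def)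
    next
      case False
      then obtain i where "i \<in> B" "i \<notin> S" by auto
      then have "(\<Prod>i\<in>A - S. ?g i) = 0"
        using assms by (intro prod_zero) auto
      with False show ?thesis by simp
    qed
  qed simp
  finally show ?thesis ..
qed

lemma sum_product_weight:
  assumes "finite A"
  shows "(\<Sum>S\<in>Pow A. product_weight t A S) = 1"
  using sum_product_weight_superset[OF assms, of "{}" t] by simp

text \<open>The expectation of a quantity that depends only on the event \<open>e \<in> S\<close>,
  which has probability \<open>t e\<close>; it is written as \<open>b\<close> plus
  \<open>a - b\<close> times the indicator.\<close>

lemma sum_product_weight_if:
  assumes "finite A" "e \<in> A"
  shows "(\<Sum>S\<in>Pow A. product_weight t A S * (if e \<in> S then a else b)) = t e * a + (1 - t e) * b"
proof -
  have "(\<Sum>S\<in>Pow A. product_weight t A S * (if e \<in> S then a else b)) =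
    (\<Sum>S\<in>Pow A. (a - b) * (if {e} \<subseteq> S then product_weight t A S else 0) + b * product_weight t A S)"
    by (intro sum.cong) (auto simp: algebra_simps)
  also have "\<dots> = (a - b) * t e + b"
    using sum_product_weight_superset[of A "{e}" t] assms
    unfolding sum.distrib sum_distrib_left[symmetric] sum_product_weight[OF assms(1)]
    by simp
  finally show ?thesis by (simp add: algebra_simps)
qed

section \<open>Two-point distributions on the unit square with prescribed moments\<close>

lemma square_le_self_imp:
  fixes x :: real
  assumes "x\<^sup>2 \<le> X" "X \<le> x"
  shows "x \<in> {0..1}"
proof -
  have "0 \<le> x * (1 - x)"
    using assms by (simp add: power2_eq_square algebra_simps)
  then show ?thesis
    by (auto simp: zero_le_mult_iff)
qed

text \<open>
  The two points lie on the line through \<open>(x, y)\<close> with direction \<open>(r, 1)\<close>, where \<open>r\<close> is the covariance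
  divided by \<open>B = Y - y\<^sup>2\<close>. At parameters \<open>T\<close> and \<open>-S\<close> with \<open>T S = B\<close> they have second variance \<open>B\<close> and the
  right covariance. The four products of a bound on \<open>T\<close> (\<open>1 - y\<close>, \<open>T2\<close>) and a bound on \<open>S\<close> (\<open>y\<close>, \<open>S2\<close>)
  coming from the unit square are all at least \<open>B\<close>, by \<open>X \<le> x\<close>, \<open>Y \<le> y\<close> and the McCormick inequalities,
  so both points can be kept inside.
\<close>

lemma two_point_moments:
  fixes x y X Y w :: real
  assumes X: "x\<^sup>2 \<le> X" "X \<le> x" and Y: "y\<^sup>2 \<le> Y" "Y \<le> y"
    and cov: "(w - x * y)\<^sup>2 \<le> (X - x\<^sup>2) * (Y - y\<^sup>2)"
    and w: "0 \<le> w" "x + y - 1 \<le> w" "w \<le> x" "w \<le> y"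
  shows "\<exists>t\<in>{0..1}. \<exists>p\<in>{0..1}. \<exists>q\<in>{0..1}. \<exists>p'\<in>{0..1}. \<exists>q'\<in>{0..1}.
    t * p + (1 - t) * q = x \<and> t * p' + (1 - t) * q' = y \<and>
    t * p\<^sup>2 + (1 - t) * q\<^sup>2 \<le> X \<and> t * p'\<^sup>2 + (1 - t) * q'\<^sup>2 \<le> Y \<and>
    t * (p * p') + (1 - t) * (q * q') = w"
proof -
  have x01: "x \<in> {0..1}" and y01: "y \<in> {0..1}"
    using square_le_self_imp[OF X] square_le_self_imp[OF Y] .
  show ?thesis
  proof (cases "w = x * y")
    case True
    \<comment> \<open>With zero covariance the point mass at \<open>(x, y)\<close> suffices.\<close>
    then show ?thesis
      using x01 y01 X Y
      by (intro bexI[of _ 1] bexI[of _ x] bexI[of _ y]) auto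
  next
    case False
    define B where "B = Y - y\<^sup>2"
    define r where "r = (w - x * y) / B"
    have "0 < (w - x * y)\<^sup>2" using False by simp
    with cov X Y have B: "0 < B"
      by (smt (verit) B_def mult_nonneg_nonpos)
    have c: "w - x * y = r * B" using B by (simp add: r_def)
    have r0: "r \<noteq> 0" using False B by (simp add: r_def)
    have "r\<^sup>2 * B * B \<le> (X - x\<^sup>2) * B"
      using cov c by (simp add: B_def power2_eq_square mult_ac)
    \<comment> \<open>The first coordinate moves \<open>r\<close> times as fast as the second, so
      its variance is \<open>r\<^sup>2 * B\<close>; the covariance hypothesis keeps this within the
      prescribed bound.\<close>
    then have rX: "r\<^sup>2 * B \<le> X - x\<^sup>2" using B by simp
    \<comment> \<open>The largest parameters for which \<open>x + T2 * r\<close> and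
      \<open>x - S2 * r\<close> stay in the unit interval; the sign of \<open>r\<close> decides
      which end is reached.\<close>
    define T2 where "T2 = (if r > 0 then (1 - x) / r else x / - r)"
    define S2 where "S2 = (if r > 0 then x / r else (1 - x) / - r)"
    have b1: "B \<le> T2 * S2"
    proof -
      have "r\<^sup>2 * (T2 * S2) = x * (1 - x)"
        using r0 by (simp add: T2_def S2_def power2_eq_square)
      moreover have "r\<^sup>2 * B \<le> x * (1 - x)"
        using rX X by (simp add: algebra_simps power2_eq_square)
      ultimately have "r\<^sup>2 * B \<le> r\<^sup>2 * (T2 * S2)" by simp
      then show ?thesis
        using r0 by (simp only: mult_le_cancel_left_pos zero_less_power2 simp_thms)
    qed
    have b2: "B \<le> (1 - y) * S2"
    proof (cases "r > 0")
      case True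
      have "r * B \<le> (1 - y) * x" using c w by (simp add: algebra_simps)
      then show ?thesis using True by (simp add: S2_def field_simps)
    next
      case False
      have "- r * B \<le> (1 - y) * (1 - x)" using c w by (simp add: algebra_simps)
      then show ?thesis using False r0 by (simp add: S2_def field_simps)
    qed
    have b3: "B \<le> y * T2"
    proof (cases "r > 0")
      case True
      have "r * B \<le> y * (1 - x)" using c w by (simp add: algebra_simps)
      then show ?thesis using True by (simp add: T2_def field_simps)
    next
      case False
      have "- r * B \<le> y * x" using c w by (simp add: algebra_simps)
      then show ?thesis using False r0 by (simp add: T2_def field_simps)
    qed
    have b4: "B \<le> y * (1 - y)"
      using Y by (simp add: B_def algebra_simps power2_eq_square)
    have T2: "0 < T2"
    proof -
      have "0 \<le> T2" using x01 by (auto simp: T2_def divide_nonneg_nonpos divide_nonneg_pos)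
      then show ?thesis using b3 B by (cases "T2 = 0") auto
    qed
    have y1: "y < 1" using b4 B y01 by (cases "y = 1") auto
    \<comment> \<open>\<open>T\<close> is taken as large as the first point allows, which makes
      \<open>S = B / T\<close> as small as possible. Since \<open>T\<close> equals one of its two
      bounds, \<open>b1\<close> to \<open>b4\<close> give both bounds on \<open>S\<close>.\<close>
    define T where "T = min (1 - y) T2"
    define S where "S = B / T"
    have T: "0 < T" "T \<le> 1 - y" "T \<le> T2" using T2 y1 by (auto simp: T_def)
    have S: "0 < S" "T * S = B" using T B by (auto simp: S_def)
    have "B \<le> y * T" "B \<le> S2 * T"
      using b1 b2 b3 b4 by (auto simp: T_def min_def mult_ac)
    then have S': "S \<le> y" "S \<le> S2" using T by (auto simp: S_def field_simps)
    have Tr: "x + T * r \<in> {0..1}"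
    proof (cases "r > 0")
      case True
      then have "T * r \<le> 1 - x" using T(3) by (simp add: T2_def field_simps)
      then show ?thesis using True T x01 by auto
    next
      case False
      then have "T * - r \<le> x" using T(3) r0 by (simp add: T2_def field_simps)
      moreover have "T * r \<le> 0" using False T by (simp add: mult_nonneg_nonpos)
      ultimately show ?thesis using x01 by auto
    qed
    have Sr: "x - S * r \<in> {0..1}"
    proof (cases "r > 0")
      case True
      then have "S * r \<le> x" using S'(2) by (simp add: S2_def field_simps)
      then show ?thesis using True S x01 by (auto intro: order_trans[OF _ x01[simplified, THEN conjunct2]])
    next
      case False
      then have "S * - r \<le> 1 - x" using S'(2) r0 by (simp add: S2_def field_simps)
      moreover have "S * r \<le> 0" using False S by (simp add: mult_nonneg_nonpos)
      ultimately show ?thesis using x01 by auto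
    qed
    \<comment> \<open>The weight for which the parameters \<open>T\<close> and \<open>- S\<close>
      have mean zero.\<close>
    define t where "t = S / (S + T)"
    have t: "t \<in> {0..1}" "t * T = (1 - t) * S"
      using S T by (auto simp: t_def field_simps)
    have tT: "t * T\<^sup>2 + (1 - t) * S\<^sup>2 = B"
    proof -
      have "t * T\<^sup>2 + (1 - t) * S\<^sup>2 = (t * T) * T + ((1 - t) * S) * S"
        by (simp add: power2_eq_square)
      also have "\<dots> = ((1 - t) * S) * T + (t * T) * S" by (simp only: t(2))
      finally show ?thesis using S(2) by (simp add: algebra_simps)
    qed
    \<comment> \<open>All five moments expand in the mean of the parameter, which is 0, and its
      second moment, which is \<open>B\<close>.\<close>
    have "t * (x + T * r) + (1 - t) * (x - S * r) = x + r * (t * T - (1 - t) * S)"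
      by (simp add: algebra_simps)
    then have m1: "t * (x + T * r) + (1 - t) * (x - S * r) = x" using t(2) by simp
    have "t * (y + T) + (1 - t) * (y - S) = y + (t * T - (1 - t) * S)"
      by (simp add: algebra_simps)
    then have m2: "t * (y + T) + (1 - t) * (y - S) = y" using t(2) by simp
    have "t * (x + T * r)\<^sup>2 + (1 - t) * (x - S * r)\<^sup>2 =
        x\<^sup>2 + 2 * x * r * (t * T - (1 - t) * S) + r\<^sup>2 * (t * T\<^sup>2 + (1 - t) * S\<^sup>2)"
      by (simp add: algebra_simps power2_eq_square)
    then have m3: "t * (x + T * r)\<^sup>2 + (1 - t) * (x - S * r)\<^sup>2 \<le> X" using t(2) tT rX by simp
    have "t * (y + T)\<^sup>2 + (1 - t) * (y - S)\<^sup>2 =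
        y\<^sup>2 + 2 * y * (t * T - (1 - t) * S) + (t * T\<^sup>2 + (1 - t) * S\<^sup>2)"
      by (simp add: algebra_simps power2_eq_square)
    then have m4: "t * (y + T)\<^sup>2 + (1 - t) * (y - S)\<^sup>2 \<le> Y" using t(2) tT by (simp add: B_def)
    have "t * ((x + T * r) * (y + T)) + (1 - t) * ((x - S * r) * (y - S)) =
        x * y + (x + y * r) * (t * T - (1 - t) * S) + r * (t * T\<^sup>2 + (1 - t) * S\<^sup>2)"
      by (simp add: algebra_simps power2_eq_square)
    then have m5: "t * ((x + T * r) * (y + T)) + (1 - t) * ((x - S * r) * (y - S)) = w"
      using t(2) tT c by simp
    have "y + T \<in> {0..1}" "y - S \<in> {0..1}" using T S S' y01 by auto
    then show ?thesis
      using t(1) Tr Sr m1 m2 m3 m4 m5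
      by (intro bexI[of _ t] bexI[of _ "x + T * r"] bexI[of _ "x - S * r"]
          bexI[of _ "y + T"] bexI[of _ "y - S"] conjI)
  qed
qed

section \<open>Product distributions over a matching\<close>

lemma doubleton_moments:
  fixes x :: "'a \<Rightarrow> real" and W :: "'a set \<Rightarrow> real"
  assumes e: "e = {i, j}" "i \<noteq> j"
    and diag: "\<And>k. k \<in> e \<Longrightarrow> (x k)\<^sup>2 \<le> W {k} \<and> W {k} \<le> x k"
    and cov: "(W e - x i * x j)\<^sup>2 \<le> (W {i} - (x i)\<^sup>2) * (W {j} - (x j)\<^sup>2)"
    and W: "0 \<le> W e" "x i + x j - 1 \<le> W e" "W e \<le> x i" "W e \<le> x j"
  shows "\<exists>t p q. t \<in> {0..1} \<and>
    (\<forall>k\<in>e. p k \<in> {0..1} \<and> q k \<in> {0..1} \<and> t * p k + (1 - t) * q k = x k \<and>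
       t * (p k)\<^sup>2 + (1 - t) * (q k)\<^sup>2 \<le> W {k}) \<and>
    (\<forall>k l. e = {k, l} \<longrightarrow> t * (p k * p l) + (1 - t) * (q k * q l) = W e)"
proof -
  have "(x i)\<^sup>2 \<le> W {i}" "W {i} \<le> x i" "(x j)\<^sup>2 \<le> W {j}" "W {j} \<le> x j"
    using diag e by auto
  from two_point_moments[OF this cov W] obtain t p q p' q' where
    "t \<in> {0..1}" "p \<in> {0..1}" "q \<in> {0..1}" "p' \<in> {0..1}" "q' \<in> {0..1}"
    "t * p + (1 - t) * q = x i" "t * p' + (1 - t) * q' = x j"
    "t * p\<^sup>2 + (1 - t) * q\<^sup>2 \<le> W {i}" "t * p'\<^sup>2 + (1 - t) * q'\<^sup>2 \<le> W {j}"
    "t * (p * p') + (1 - t) * (q * q') = W e"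
    by blast
  note tp = this
  \<comment> \<open>As functions on the edge the two points no longer depend on which end is called
    \<open>i\<close>, so one choice per unordered edge is enough.\<close>
  define f where "f k = (if k = i then p else p')" for k
  define g where "g k = (if k = i then q else q')" for k
  have "\<forall>k\<in>e. f k \<in> {0..1} \<and> g k \<in> {0..1} \<and> t * f k + (1 - t) * g k = x k \<and>
       t * (f k)\<^sup>2 + (1 - t) * (g k)\<^sup>2 \<le> W {k}"
    using tp e by (simp add: f_def g_def)
  moreover have "\<forall>k l. e = {k, l} \<longrightarrow> t * (f k * f l) + (1 - t) * (g k * g l) = W e"
    using tp(10) e by (auto simp: f_def g_def doubleton_eq_iff mult_ac)
  ultimately show ?thesis
    using tp(1) by blast
qed

text \<open>Each edge of the matching draws one of its two points independently, and
  \<open>D\<close> collects the edges that draw the first one. Every moment in question involves a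
  single edge, so the product distribution reduces to the two-point distribution of that
  edge.\<close>

lemma matching_moments:
  fixes x :: "'a \<Rightarrow> real" and W :: "'a set \<Rightarrow> real"
  assumes fin: "finite E"
    and E: "\<And>e. e \<in> E \<Longrightarrow> e \<subseteq> P \<and> card e = 2"
    and disj: "\<And>d e. d \<in> E \<Longrightarrow> e \<in> E \<Longrightarrow> d \<inter> e \<noteq> {} \<Longrightarrow> d = e"
    and diag: "\<And>i. i \<in> P \<Longrightarrow> (x i)\<^sup>2 \<le> W {i} \<and> W {i} \<le> x i"
    and cov: "\<And>i j. {i, j} \<in> E \<Longrightarrow> (W {i, j} - x i * x j)\<^sup>2 \<le> (W {i} - (x i)\<^sup>2) * (W {j} - (x j)\<^sup>2)"
    and W: "\<And>i j. {i, j} \<in> E \<Longrightarrow> 0 \<le> W {i, j} \<and> x i + x j - 1 \<le> W {i, j} \<and> W {i, j} \<le> x i \<and> W {i, j} \<le> x j"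
  shows "\<exists>m y. (\<forall>D\<in>Pow E. 0 \<le> m D) \<and> sum m (Pow E) = 1 \<and>
    (\<forall>i\<in>P. (\<forall>D. y D i \<in> {0..1}) \<and> (\<Sum>D\<in>Pow E. m D * y D i) = x i \<and>
       (\<Sum>D\<in>Pow E. m D * (y D i)\<^sup>2) \<le> W {i}) \<and>
    (\<forall>i j. {i, j} \<in> E \<longrightarrow> (\<Sum>D\<in>Pow E. m D * (y D i * y D j)) = W {i, j})"
proof -
  have "\<forall>e\<in>E. \<exists>r. case r of (t, p, q) \<Rightarrow> t \<in> {0..1} \<and>
    (\<forall>k\<in>e. p k \<in> {0..1} \<and> q k \<in> {0..1} \<and> t * p k + (1 - t) * q k = x k \<and>
       t * (p k)\<^sup>2 + (1 - t) * (q k)\<^sup>2 \<le> W {k}) \<and>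
    (\<forall>k l. e = {k, l} \<longrightarrow> t * (p k * p l) + (1 - t) * (q k * q l) = W e)"
  proof
    fix e assume e: "e \<in> E"
    then obtain i j where ij: "e = {i, j}" "i \<noteq> j"
      using E by (meson card_2_iff)
    show "\<exists>r. case r of (t, p, q) \<Rightarrow> t \<in> {0..1} \<and>
      (\<forall>k\<in>e. p k \<in> {0..1} \<and> q k \<in> {0..1} \<and> t * p k + (1 - t) * q k = x k \<and>
         t * (p k)\<^sup>2 + (1 - t) * (q k)\<^sup>2 \<le> W {k}) \<and>
      (\<forall>k l. e = {k, l} \<longrightarrow> t * (p k * p l) + (1 - t) * (q k * q l) = W e)"
      unfolding split_paired_Ex prod.case
      by (rule doubleton_moments[OF ij]) (use diag cov[of i j] W[of i j] E[OF e] e ij(1) in auto)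
  qed
  then obtain r where r: "\<forall>e\<in>E. case r e of (t, p, q) \<Rightarrow> t \<in> {0..1} \<and>
    (\<forall>k\<in>e. p k \<in> {0..1} \<and> q k \<in> {0..1} \<and> t * p k + (1 - t) * q k = x k \<and>
       t * (p k)\<^sup>2 + (1 - t) * (q k)\<^sup>2 \<le> W {k}) \<and>
    (\<forall>k l. e = {k, l} \<longrightarrow> t * (p k * p l) + (1 - t) * (q k * q l) = W e)"
    by (rule bchoice[THEN exE]) blast
  define t where "t e = fst (r e)" for e
  define p where "p e = fst (snd (r e))" for e
  define q where "q e = snd (snd (r e))" for e
  have t: "t e \<in> {0..1}" if "e \<in> E" for e
    using r that by (auto simp: t_def split_beta)
  have node: "p e k \<in> {0..1}" "q e k \<in> {0..1}" "t e * p e k + (1 - t e) * q e k = x k"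
    "t e * (p e k)\<^sup>2 + (1 - t e) * (q e k)\<^sup>2 \<le> W {k}" if "e \<in> E" "k \<in> e" for e k
    using r that unfolding t_def p_def q_def by (auto simp: split_beta)
  have edge: "t e * (p e k * p e l) + (1 - t e) * (q e k * q e l) = W e" if "e \<in> E" "e = {k, l}" for e k l
    using r that unfolding t_def p_def q_def by (auto simp: split_beta)
  \<comment> \<open>At most one edge covers \<open>i\<close>, so \<open>THE\<close> picks it. An
    uncovered node stays at its mean \<open>x i\<close>, whose square is at most
    \<open>W {i}\<close>.\<close>
  define y where "y D i = (if \<exists>e\<in>E. i \<in> e then
    let e = THE e. e \<in> E \<and> i \<in> e in if e \<in> D then p e i else q e i else x i)" for D i
  have y: "y D i = (if e \<in> D then p e i else q e i)" if "e \<in> E" "i \<in> e" for D e i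
  proof -
    have "(THE e. e \<in> E \<and> i \<in> e) = e"
      using that disj by (intro the_equality) blast+
    then show ?thesis using that by (auto simp: y_def)
  qed
  have y': "y D i = x i" if "\<not> (\<exists>e\<in>E. i \<in> e)" for D i
    using that by (auto simp: y_def)
  let ?m = "product_weight t E"
  have one: "(\<Sum>D\<in>Pow E. ?m D) = 1"
    by (rule sum_product_weight[OF fin])
  have P: "(\<forall>D. y D i \<in> {0..1}) \<and> (\<Sum>D\<in>Pow E. ?m D * y D i) = x i \<and>
       (\<Sum>D\<in>Pow E. ?m D * (y D i)\<^sup>2) \<le> W {i}" if i: "i \<in> P" for i
  proof (cases "\<exists>e\<in>E. i \<in> e")
    case True
    then obtain e where e: "e \<in> E" "i \<in> e" by blast
    have "(y D i)\<^sup>2 = (if e \<in> D then (p e i)\<^sup>2 else (q e i)\<^sup>2)" for D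
      by (simp add: y[OF e])
    then show ?thesis
      using node[OF e] by (simp add: y[OF e] sum_product_weight_if[OF fin e(1)])
  next
    case False
    have "x i \<in> {0..1}"
      using diag[OF i] square_le_self_imp by blast
    moreover have "(\<Sum>D\<in>Pow E. ?m D * c) = c" for c
      unfolding sum_distrib_right[symmetric] one by simp
    ultimately show ?thesis
      using diag[OF i] by (simp add: y'[OF False])
  qed
  have EE: "(\<Sum>D\<in>Pow E. ?m D * (y D i * y D j)) = W {i, j}" if e: "{i, j} \<in> E" for i j
  proof -
    have "y D i * y D j = (if {i, j} \<in> D then p {i, j} i * p {i, j} j else q {i, j} i * q {i, j} j)" for D
      by (simp add: y[OF e])
    then show ?thesis
      using edge[OF e refl] by (simp add: sum_product_weight_if[OF fin e])
  qed
  have "\<forall>D\<in>Pow E. 0 \<le> ?m D"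
    using t by (auto intro: product_weight_nonneg)
  with one P EE show ?thesis by blast
qed

section \<open>Moment matrices and covariances\<close>

lemma psd_on_subset:
  assumes "psd_on R h" "finite R" "R' \<subseteq> R"
  shows "psd_on R' h"
  unfolding psd_on_def
proof
  fix v :: "'a \<Rightarrow> real"
  \<comment> \<open>Test vectors on the smaller set are extended by zero.\<close>
  let ?v = "\<lambda>p. if p \<in> R' then v p else 0"
  have "0 \<le> (\<Sum>p\<in>R. \<Sum>q\<in>R. ?v p * ?v q * h p q)"
    using assms(1) unfolding psd_on_def by (rule spec)
  also have "\<dots> = (\<Sum>p\<in>R'. \<Sum>q\<in>R. ?v p * ?v q * h p q)"
    by (rule sum.mono_neutral_right) (use assms(2,3) in auto)
  also have "\<dots> = (\<Sum>p\<in>R'. \<Sum>q\<in>R'. ?v p * ?v q * h p q)"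
    by (intro sum.cong[OF refl] sum.mono_neutral_right) (use assms(2,3) in auto)
  also have "\<dots> = (\<Sum>p\<in>R'. \<Sum>q\<in>R'. v p * v q * h p q)"
    by (simp cong: sum.cong)
  finally show "0 \<le> (\<Sum>p\<in>R'. \<Sum>q\<in>R'. v p * v q * h p q)" .
qed

lemma quadratic_form_nonneg:
  fixes A B c :: real
  assumes form: "\<And>a b. 0 \<le> A * a\<^sup>2 + 2 * c * (a * b) + B * b\<^sup>2"
  shows "0 \<le> A" "0 \<le> B" "c\<^sup>2 \<le> A * B"
proof -
  show A: "0 \<le> A" using form[of 1 0] by simp
  show "0 \<le> B" using form[of 0 1] by simp
  show "c\<^sup>2 \<le> A * B"
  proof (cases "A = 0")
    case True
    have "c = 0"
    proof (rule ccontr)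
      assume "c \<noteq> 0"
      then show False
        \<comment> \<open>With \<open>A = 0\<close> the form takes the value -1 here.\<close>
        using form[of "- (B + 1) / (2 * c)" 1] True by simp
    qed
    with True show ?thesis by simp
  next
    case False
    \<comment> \<open>The value of the form at \<open>a = - c\<close>, \<open>b = A\<close>.\<close>
    have "0 \<le> A * (A * B - c\<^sup>2)"
      using form[of "- c" A] by (simp add: algebra_simps power2_eq_square)
    with False A show ?thesis by (simp add: zero_le_mult_iff)
  qed
qed

text \<open>\<open>None\<close> stands for the constant function 1 and \<open>Some i\<close> for the
  coordinate of \<open>i\<close>; for a measure of total mass \<open>l\<close> the entries are the
  integrals of products of two such functions. The diagonal entry at \<open>Some i\<close> is
  \<open>W {i}\<close>.\<close>

definition moment_matrix ::
    "real \<Rightarrow> ('a \<Rightarrow> real) \<Rightarrow> ('a set \<Rightarrow> real) \<Rightarrow> 'a option \<Rightarrow> 'a option \<Rightarrow> real" where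
  "moment_matrix l x W p q = (case p of
     None \<Rightarrow> (case q of None \<Rightarrow> l | Some j \<Rightarrow> x j) |
     Some i \<Rightarrow> (case q of None \<Rightarrow> x i | Some j \<Rightarrow> W {i, j}))"

lemma moment_matrix_psd_single:
  assumes "psd_on (insert None (Some ` P)) (moment_matrix l x W)" "finite P" "i \<in> P"
  shows "0 \<le> W {i}" "(x i)\<^sup>2 \<le> l * W {i}"
proof -
  have psd: "psd_on {None, Some i} (moment_matrix l x W)"
    by (rule psd_on_subset[OF assms(1)]) (use assms in auto)
  have "0 \<le> l * a\<^sup>2 + 2 * x i * (a * b) + W {i} * b\<^sup>2" for a b
    using psd[unfolded psd_on_def, rule_format, of "\<lambda>p. if p = None then a else b"]
    by (simp add: moment_matrix_def power2_eq_square algebra_simps)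
  from quadratic_form_nonneg[OF this] show "0 \<le> W {i}" "(x i)\<^sup>2 \<le> l * W {i}" by auto
qed

text \<open>The Schur complement of the entry \<open>l\<close>, divided by \<open>l\<close>, is the
  covariance matrix of the normalised moments. It is again positive semidefinite, so its determinant
  is nonnegative.\<close>

lemma moment_matrix_psd_pair:
  assumes "psd_on (insert None (Some ` P)) (moment_matrix l x W)" "finite P"
    and ij: "i \<in> P" "j \<in> P" "i \<noteq> j" and l: "0 < l"
  shows "(W {i, j} / l - x i / l * (x j / l))\<^sup>2 \<le>
    (W {i} / l - (x i / l)\<^sup>2) * (W {j} / l - (x j / l)\<^sup>2)"
proof -
  have psd: "psd_on {None, Some i, Some j} (moment_matrix l x W)"
    by (rule psd_on_subset[OF assms(1)]) (use assms in auto)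
  have form: "0 \<le> l * a\<^sup>2 + 2 * x i * (a * b) + 2 * x j * (a * c) +
      W {i} * b\<^sup>2 + 2 * W {i, j} * (b * c) + W {j} * c\<^sup>2" for a b c
    using psd[unfolded psd_on_def, rule_format,
        of "\<lambda>p. if p = None then a else if p = Some i then b else c"] ij(3)
    by (simp add: moment_matrix_def power2_eq_square algebra_simps insert_commute)
  have "0 \<le> (W {i} / l - (x i / l)\<^sup>2) * b\<^sup>2 + 2 * (W {i, j} / l - x i / l * (x j / l)) * (b * c) +
      (W {j} / l - (x j / l)\<^sup>2) * c\<^sup>2" (is "0 \<le> ?Q") for b c
  proof -
    \<comment> \<open>The minimiser of the form in \<open>a\<close> for fixed \<open>b\<close> and
      \<open>c\<close>.\<close>
    let ?a = "- (b * x i + c * x j) / l"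
    have "l * ?Q = l * ?a\<^sup>2 + 2 * x i * (?a * b) + 2 * x j * (?a * c) +
        W {i} * b\<^sup>2 + 2 * W {i, j} * (b * c) + W {j} * c\<^sup>2"
      using l by (simp add: field_simps power2_eq_square)
    with form[of ?a b c] have "0 \<le> l * ?Q" by simp
    then show ?thesis using l by (simp add: zero_le_mult_iff)
  qed
  from quadratic_form_nonneg(3)[OF this] show ?thesis .
qed

text \<open>The version of \<open>matching_moments\<close> for total mass \<open>l\<close>: for
  positive \<open>l\<close> all moments are divided by \<open>l\<close>, while \<open>l = 0\<close>
  is treated separately.\<close>

lemma scaled_matching_moments:
  fixes x :: "'a \<Rightarrow> real" and W :: "'a set \<Rightarrow> real"
  assumes fin: "finite P"
    and E: "\<And>e. e \<in> E \<Longrightarrow> e \<subseteq> P \<and> card e = 2"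
    and disj: "\<And>d e. d \<in> E \<Longrightarrow> e \<in> E \<Longrightarrow> d \<inter> e \<noteq> {} \<Longrightarrow> d = e"
    and psd: "psd_on (insert None (Some ` P)) (moment_matrix l x W)"
    and diag: "\<And>i. i \<in> P \<Longrightarrow> W {i} \<le> x i"
    and W: "\<And>i j. {i, j} \<in> E \<Longrightarrow> 0 \<le> W {i, j} \<and> x i + x j - l \<le> W {i, j} \<and> W {i, j} \<le> x i"
  shows "0 \<le> l \<and> (\<exists>m y. (\<forall>D\<in>Pow E. 0 \<le> m D) \<and> sum m (Pow E) = 1 \<and>
    (\<forall>i\<in>P. (\<forall>D. y D i \<in> {0..1}) \<and> l * (\<Sum>D\<in>Pow E. m D * y D i) = x i \<and>
       l * (\<Sum>D\<in>Pow E. m D * (y D i)\<^sup>2) \<le> W {i}) \<and>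
    (\<forall>i j. {i, j} \<in> E \<longrightarrow> l * (\<Sum>D\<in>Pow E. m D * (y D i * y D j)) = W {i, j}))"
proof -
  have finE: "finite E"
    by (rule finite_subset[of _ "Pow P"]) (use E fin in auto)
  have "psd_on {None} (moment_matrix l x W)"
    by (rule psd_on_subset[OF psd]) (use fin in auto)
  then have l0: "0 \<le> l"
    unfolding psd_on_def by (auto simp: moment_matrix_def dest: spec[of _ "\<lambda>_. 1"])
  note single = moment_matrix_psd_single[OF psd fin]
  have W': "W {i, j} \<le> x j" if "{i, j} \<in> E" for i j
    using W[of j i] that by (simp add: insert_commute)
  have ends: "i \<in> P" "j \<in> P" "i \<noteq> j" if "{i, j} \<in> E" for i j
    using E[OF that] by auto
  show ?thesis
  proof (cases "l = 0")
    case True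
    \<comment> \<open>Zero mass forces all first moments to vanish, then by the bounds on
      \<open>W\<close> the diagonal and edge moments too.\<close>
    have x: "x i = 0" if "i \<in> P" for i
      using single(2)[OF that] True by simp
    have "W {i} = 0" if "i \<in> P" for i
      using single(1)[OF that] diag[OF that] x[OF that] by simp
    moreover have "W {i, j} = 0" if "{i, j} \<in> E" for i j
      using W[OF that] x ends[OF that] by force
    \<comment> \<open>Any probability distribution would do; a point mass is the simplest.\<close>
    moreover have "(\<Sum>D\<in>Pow E. if D = {} then 1 else 0 :: real) = 1"
      using finE by simp
    ultimately show ?thesis
      using True x
      by (intro conjI exI[of _ "\<lambda>D. if D = {} then 1 else 0"] exI[of _ "\<lambda>_ _. 0"]) auto
  next
    case False
    with l0 have l: "0 < l" by simp
    have "(x i / l)\<^sup>2 \<le> W {i} / l \<and> W {i} / l \<le> x i / l" if "i \<in> P" for i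
      using single(2)[OF that] diag[OF that] l by (simp add: field_simps power2_eq_square)
    moreover have "(W {i, j} / l - x i / l * (x j / l))\<^sup>2 \<le>
        (W {i} / l - (x i / l)\<^sup>2) * (W {j} / l - (x j / l)\<^sup>2)" if "{i, j} \<in> E" for i j
      by (rule moment_matrix_psd_pair[OF psd fin ends[OF that] l])
    moreover have "0 \<le> W {i, j} / l \<and> x i / l + x j / l - 1 \<le> W {i, j} / l \<and>
        W {i, j} / l \<le> x i / l \<and> W {i, j} / l \<le> x j / l" if "{i, j} \<in> E" for i j
    proof (intro conjI)
      have "(x i + x j - l) / l \<le> W {i, j} / l"
        using W[OF that] l by (intro divide_right_mono) auto
      then show "x i / l + x j / l - 1 \<le> W {i, j} / l"
        using l by (simp add: add_divide_distrib diff_divide_distrib)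
    qed (use W[OF that] W'[OF that] l in \<open>auto simp: divide_right_mono\<close>)
    ultimately obtain m y where "\<forall>D\<in>Pow E. 0 \<le> m D" "sum m (Pow E) = 1"
      "\<forall>i\<in>P. (\<forall>D. y D i \<in> {0..1}) \<and> (\<Sum>D\<in>Pow E. m D * y D i) = x i / l \<and>
         (\<Sum>D\<in>Pow E. m D * (y D i)\<^sup>2) \<le> W {i} / l"
      "\<forall>i j. {i, j} \<in> E \<longrightarrow> (\<Sum>D\<in>Pow E. m D * (y D i * y D j)) = W {i, j} / l"
      using matching_moments[OF finE E disj, where x = "\<lambda>i. x i / l" and W = "\<lambda>e. W e / l"] by blast
    then show ?thesis
      using l by (intro conjI exI[of _ m] exI[of _ y]) (auto simp: field_simps)
  qed
qed

section \<open>The edges inside \<open>V\<^sup>+\<close> form a matching\<close>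

definition plus_edges :: "'a loop_graph \<Rightarrow> 'a set set" where
  "plus_edges G = {e \<in> edges G. e \<subseteq> plus_nodes G}"

lemma edge_doubleton:
  assumes "is_loop_graph G" "e \<in> edges G"
  obtains i j where "e = {i, j}" "i \<noteq> j" "i \<in> nodes G" "j \<in> nodes G"
  using assms unfolding is_loop_graph_def by blast

text \<open>Two distinct edges through a common node \<open>i\<close> would put three nodes into the
  component of \<open>i\<close>.\<close>

lemma plus_edges_matching:
  assumes G: "is_loop_graph G" "no_connected_plus_triplets G"
    and de: "d \<in> plus_edges G" "e \<in> plus_edges G" "d \<inter> e \<noteq> {}"
  shows "d = e"
proof (rule ccontr)
  assume "d \<noteq> e"
  have card: "card d = 2" "card e = 2"
    using de(1,2) edge_doubleton[OF G(1)] unfolding plus_edges_def by (metis (no_types, lifting) card_2_iff mem_Collect_eq)+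
  obtain i where i: "i \<in> d" "i \<in> e" using de(3) by blast
  obtain j where j: "d = {i, j}" "i \<noteq> j"
    using card(1) i(1) by (metis card_2_iff insertE insert_commute singletonD)
  obtain k where k: "e = {i, k}" "i \<noteq> k"
    using card(2) i(2) by (metis card_2_iff insertE insert_commute singletonD)
  let ?P = "plus_nodes G"
  let ?r = "{(i, j) \<in> ?P \<times> ?P. (i, j) \<in> (induced_adj G ?P)\<^sup>*}"
  have P: "i \<in> ?P" "j \<in> ?P" "k \<in> ?P"
    using de(1,2) j k by (auto simp: plus_edges_def)
  have "(i, j) \<in> induced_adj G ?P" "(i, k) \<in> induced_adj G ?P"
    using P de(1,2) j k by (auto simp: induced_adj_def plus_edges_def)
  then have sub: "{i, j, k} \<subseteq> ?r `` {i}"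
    using P by auto
  have "finite ?P"
    using G(1) by (simp add: is_loop_graph_def plus_nodes_def)
  then have "finite (?r `` {i})"
    by (rule rev_finite_subset) auto
  then have "card {i, j, k} \<le> card (?r `` {i})"
    using sub by (rule card_mono)
  moreover have "?r `` {i} \<in> induced_components G ?P"
    unfolding induced_components_def using P(1) by (rule quotientI)
  then have "card (?r `` {i}) \<le> 2"
    using G(2) by (simp add: no_connected_plus_triplets_def)
  moreover have "card {i, j, k} = 3"
    using j k \<open>d \<noteq> e\<close> by auto
  ultimately show False by simp
qed

section \<open>The lifted formulation\<close>

text \<open>For each \<open>S\<close>, \<open>None\<close> names the mass, \<open>Node i\<close> a
  first moment and \<open>Quad {i, j}\<close> a second moment. All pairs in \<open>V\<^sup>+\<close>
  occur, \<open>i = j\<close> included, because the moment matrix has an entry for each of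
  them.\<close>

definition aux_index :: "'a loop_graph \<Rightarrow> ('a set \<times> 'a coord option) set" where
  "aux_index G = Pow (nodes G - plus_nodes G) \<times>
     insert None (Some ` (Node ` plus_nodes G \<union> Quad ` {{i, j} | i j. i \<in> plus_nodes G \<and> j \<in> plus_nodes G}))"

definition mass :: "('k + 'a set \<times> 'a coord option \<Rightarrow> real) \<Rightarrow> 'a set \<Rightarrow> real" where
  "mass w S = w (Inr (S, None))"

definition first_moment :: "('k + 'a set \<times> 'a coord option \<Rightarrow> real) \<Rightarrow> 'a set \<Rightarrow> 'a \<Rightarrow> real" where
  "first_moment w S i = w (Inr (S, Some (Node i)))"

definition second_moment :: "('k + 'a set \<times> 'a coord option \<Rightarrow> real) \<Rightarrow> 'a set \<Rightarrow> 'a set \<Rightarrow> real" where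
  "second_moment w S e = w (Inr (S, Some (Quad e)))"

text \<open>
  The contribution of \<open>S\<close> to the coordinate \<open>k\<close>, when the nodes outside \<open>V\<^sup>+\<close> with value 1 are those in \<open>S\<close>.
  In the last line, \<open>e\<close> is an edge with exactly one end in \<open>V\<^sup>+\<close>, so the sum has a single term.
\<close>

definition moment_coord ::
    "'a loop_graph \<Rightarrow> 'a set \<Rightarrow> real \<Rightarrow> ('a \<Rightarrow> real) \<Rightarrow> ('a set \<Rightarrow> real) \<Rightarrow> 'a coord \<Rightarrow> real" where
  "moment_coord G S l x W k = (case k of
     Node i \<Rightarrow> if i \<in> plus_nodes G then x i else if i \<in> S then l else 0 |
     Quad e \<Rightarrow>
       if e \<subseteq> plus_nodes G then W e
       else if \<not> e - plus_nodes G \<subseteq> S then 0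
       else if e \<inter> plus_nodes G = {} then l
       else (\<Sum>i\<in>e \<inter> plus_nodes G. x i))"

text \<open>Names for the inequalities, so that their number is bounded by sizes of images.
  \<open>Nonneg\<close>, \<open>Lower\<close> and \<open>Upper\<close> are the McCormick
  inequalities; the two \<open>Link\<close> families tie an original coordinate to the lifted
  moments.\<close>

datatype 'a ineq_index =
    Mass_le | Mass_ge
  | Diag "'a set" 'a
  | Nonneg "'a set" "'a set"
  | Lower "'a set" "'a set"
  | Upper "'a set" "'a set" 'a
  | Link_le "'a coord" | Link_ge "'a coord"

text \<open>A plus loop coordinate may exceed its lifted value and a minus loop coordinate may fall
  below it, so each keeps one link inequality. All other coordinates get both, that is, an
  equality.\<close>

definition ineq_set :: "'a loop_graph \<Rightarrow> 'a ineq_index set" where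
  "ineq_set G = {Mass_le, Mass_ge} \<union>
     (\<lambda>(S, i). Diag S i) ` (Pow (nodes G - plus_nodes G) \<times> plus_nodes G) \<union>
     (\<lambda>(S, e). Nonneg S e) ` (Pow (nodes G - plus_nodes G) \<times> plus_edges G) \<union>
     (\<lambda>(S, e). Lower S e) ` (Pow (nodes G - plus_nodes G) \<times> plus_edges G) \<union>
     (\<lambda>(S, e, i). Upper S e i) ` (Pow (nodes G - plus_nodes G) \<times> (SIGMA e:plus_edges G. e)) \<union>
     Link_le ` (coords G - Quad ` plus_loops G) \<union>
     Link_ge ` (coords G - Quad ` minus_loops G)"

fun ineq_lhs :: "'a loop_graph \<Rightarrow> 'a ineq_index \<Rightarrow>
    ('a coord + 'a set \<times> 'a coord option \<Rightarrow> real) \<Rightarrow> real" where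
  "ineq_lhs G Mass_le w = (\<Sum>S\<in>Pow (nodes G - plus_nodes G). mass w S)"
| "ineq_lhs G Mass_ge w = - (\<Sum>S\<in>Pow (nodes G - plus_nodes G). mass w S)"
| "ineq_lhs G (Diag S i) w = second_moment w S {i} - first_moment w S i"
| "ineq_lhs G (Nonneg S e) w = - second_moment w S e"
| "ineq_lhs G (Lower S e) w = (\<Sum>i\<in>e. first_moment w S i) - mass w S - second_moment w S e"
| "ineq_lhs G (Upper S e i) w = second_moment w S e - first_moment w S i"
| "ineq_lhs G (Link_le k) w = w (Inl k) -
    (\<Sum>S\<in>Pow (nodes G - plus_nodes G). moment_coord G S (mass w S) (first_moment w S) (second_moment w S) k)"
| "ineq_lhs G (Link_ge k) w =
    (\<Sum>S\<in>Pow (nodes G - plus_nodes G). moment_coord G S (mass w S) (first_moment w S) (second_moment w S) k) -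
    w (Inl k)"

fun ineq_rhs :: "'a ineq_index \<Rightarrow> real" where
  "ineq_rhs Mass_le = 1"
| "ineq_rhs Mass_ge = - 1"
| "ineq_rhs _ = 0"

text \<open>The system in terms of masses and moments, free of the index encoding; both inclusions
  between \<open>QP G\<close> and the lifted set are proved from this form.\<close>

definition lifted_point ::
    "'a loop_graph \<Rightarrow> ('a coord \<Rightarrow> real) \<Rightarrow> ('a set \<Rightarrow> real) \<Rightarrow> ('a set \<Rightarrow> 'a \<Rightarrow> real) \<Rightarrow>
     ('a set \<Rightarrow> 'a set \<Rightarrow> real) \<Rightarrow> bool" where
  "lifted_point G z l x W \<longleftrightarrow>
     (\<Sum>S\<in>Pow (nodes G - plus_nodes G). l S) = 1 \<and>
     (\<forall>S\<in>Pow (nodes G - plus_nodes G).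
        psd_on (insert None (Some ` plus_nodes G)) (moment_matrix (l S) (x S) (W S)) \<and>
        (\<forall>i\<in>plus_nodes G. W S {i} \<le> x S i) \<and>
        (\<forall>e\<in>plus_edges G. 0 \<le> W S e \<and> (\<Sum>i\<in>e. x S i) - l S \<le> W S e \<and> (\<forall>i\<in>e. W S e \<le> x S i))) \<and>
     (\<forall>k\<in>coords G - Quad ` plus_loops G.
        z k \<le> (\<Sum>S\<in>Pow (nodes G - plus_nodes G). moment_coord G S (l S) (x S) (W S) k)) \<and>
     (\<forall>k\<in>coords G - Quad ` minus_loops G.
        (\<Sum>S\<in>Pow (nodes G - plus_nodes G). moment_coord G S (l S) (x S) (W S) k) \<le> z k)"

abbreviation lifted_set :: "'a loop_graph \<Rightarrow> ('a coord \<Rightarrow>\<^sub>0 real) set" where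
  "lifted_set G \<equiv> feasible_set (coords G) (ineq_set G) (ineq_lhs G) ineq_rhs
     (Pow (nodes G - plus_nodes G)) (insert None (Some ` plus_nodes G))
     (\<lambda>S p q w. moment_matrix (mass w S) (first_moment w S) (second_moment w S) p q)"

lemma ineq_set_holds_iff:
  "(\<forall>i\<in>ineq_set G. ineq_lhs G i w \<le> ineq_rhs i) \<and>
   (\<forall>S\<in>Pow (nodes G - plus_nodes G). psd_on (insert None (Some ` plus_nodes G))
      (\<lambda>p q. moment_matrix (mass w S) (first_moment w S) (second_moment w S) p q)) \<longleftrightarrow>
   lifted_point G (\<lambda>k. w (Inl k)) (mass w) (first_moment w) (second_moment w)"
  unfolding ineq_set_def lifted_point_def ball_Un ball_simps image_iff bex_simps
  by (simp add: ball_Un) auto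

lemma mem_lifted_set_iff:
  "z \<in> lifted_set G \<longleftrightarrow> z \<in> vectors_on (coords G) \<and>
     (\<exists>l x W. lifted_point G (Poly_Mapping.lookup z) l x W)"
proof
  assume "z \<in> lifted_set G"
  then obtain u where z: "z \<in> vectors_on (coords G)"
    and u: "\<forall>i\<in>ineq_set G. ineq_lhs G i (case_sum (Poly_Mapping.lookup z) u) \<le> ineq_rhs i"
      "\<forall>S\<in>Pow (nodes G - plus_nodes G). psd_on (insert None (Some ` plus_nodes G))
        (\<lambda>p q. moment_matrix (mass (case_sum (Poly_Mapping.lookup z) u) S)
          (first_moment (case_sum (Poly_Mapping.lookup z) u) S)
          (second_moment (case_sum (Poly_Mapping.lookup z) u) S) p q)"
    unfolding feasible_set_def by blast
  from u ineq_set_holds_iff[of G "case_sum (Poly_Mapping.lookup z) u"] z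
  show "z \<in> vectors_on (coords G) \<and> (\<exists>l x W. lifted_point G (Poly_Mapping.lookup z) l x W)"
    by (auto simp only: sum.case)
next
  assume "z \<in> vectors_on (coords G) \<and> (\<exists>l x W. lifted_point G (Poly_Mapping.lookup z) l x W)"
  then obtain l x W where z: "z \<in> vectors_on (coords G)"
    and lp: "lifted_point G (Poly_Mapping.lookup z) l x W" by blast
  define u where "u c = (case c of (S, None) \<Rightarrow> l S | (S, Some (Node i)) \<Rightarrow> x S i | (S, Some (Quad e)) \<Rightarrow> W S e)" for c
  define w where "w = case_sum (Poly_Mapping.lookup z) u"
  have "mass w = l" "first_moment w = x" "second_moment w = W" "(\<lambda>k. w (Inl k)) = Poly_Mapping.lookup z"
    by (auto simp: fun_eq_iff mass_def first_moment_def second_moment_def w_def u_def)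
  with lp have "lifted_point G (\<lambda>k. w (Inl k)) (mass w) (first_moment w) (second_moment w)" by simp
  from this[folded ineq_set_holds_iff] z show "z \<in> lifted_set G"
    unfolding feasible_set_def w_def by blast
qed

section \<open>Counting variables and inequalities\<close>

lemma finite_coords:
  assumes "is_loop_graph G"
  shows "finite (coords G)" "card (coords G) \<le> 2 * 2 ^ card (nodes G)"
proof -
  have fin: "finite (nodes G)" using assms by (simp add: is_loop_graph_def)
  \<comment> \<open>Edges and loops are subsets of \<open>nodes G\<close>, so there are at most
    \<open>2 ^ card (nodes G)\<close> coordinates of the form \<open>Quad\<close>.\<close>
  have sub: "edges G \<union> loops G \<subseteq> Pow (nodes G)"
    using assms unfolding is_loop_graph_def by blast
  show "finite (coords G)"
    unfolding coords_def using fin finite_subset[OF sub] by simp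
  have "card (coords G) \<le> card (Node ` nodes G) + card (Quad ` (edges G \<union> loops G))"
    unfolding coords_def by (rule card_Un_le)
  also have "\<dots> \<le> card (nodes G) + card (Pow (nodes G))"
    using fin card_mono[OF _ sub] card_image_le[OF fin, of Node]
      card_image_le[OF finite_subset[OF sub], of Quad] by (fastforce intro: add_mono)
  also have "\<dots> \<le> 2 * 2 ^ card (nodes G)"
    using less_exp[of "card (nodes G)"] by (simp add: card_Pow fin)
  finally show "card (coords G) \<le> 2 * 2 ^ card (nodes G)" .
qed

lemma plus_nodes_finite:
  assumes "is_loop_graph G"
  shows "finite (plus_nodes G)" "finite (nodes G - plus_nodes G)"
    "finite (plus_edges G)" "card (plus_edges G) \<le> 2 ^ card (plus_nodes G)"
    "2 ^ card (nodes G - plus_nodes G) * 2 ^ card (plus_nodes G) = (2 ^ card (nodes G) :: nat)"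
proof -
  have fin: "finite (nodes G)" using assms by (simp add: is_loop_graph_def)
  show P: "finite (plus_nodes G)" and "finite (nodes G - plus_nodes G)"
    using fin by (simp_all add: plus_nodes_def)
  have sub: "plus_edges G \<subseteq> Pow (plus_nodes G)" by (auto simp: plus_edges_def)
  show "finite (plus_edges G)" using finite_subset[OF sub] P by simp
  show "card (plus_edges G) \<le> 2 ^ card (plus_nodes G)"
    using card_mono[OF _ sub] P by (simp add: card_Pow)
  have "card (nodes G) = card (nodes G - plus_nodes G) + card (plus_nodes G)"
    using card_Diff_subset[OF P, of "nodes G"] card_mono[OF fin, of "plus_nodes G"]
    by (simp add: plus_nodes_def subset_iff)
  then show "2 ^ card (nodes G - plus_nodes G) * 2 ^ card (plus_nodes G) = (2 ^ card (nodes G) :: nat)"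
    by (simp add: power_add)
qed

text \<open>With \<open>p = card (plus_nodes G)\<close>, each \<open>S\<close> has one mass,
  \<open>p\<close> first moments and at most \<open>2 ^ p\<close> second moments, each number being
  at most \<open>2 ^ p\<close>.\<close>

lemma card_aux_index:
  assumes "is_loop_graph G"
  shows "finite (aux_index G)" "card (aux_index G) \<le> 3 * 2 ^ card (nodes G)"
proof -
  note fin = plus_nodes_finite[OF assms]
  let ?P = "plus_nodes G"
  let ?Q = "{{i, j} | i j. i \<in> ?P \<and> j \<in> ?P}"
  let ?T = "insert None (Some ` (Node ` ?P \<union> Quad ` ?Q))"
  have sub: "?Q \<subseteq> Pow ?P" by auto
  have finQ: "finite ?Q" using finite_subset[OF sub] fin by simp
  have Q: "card ?Q \<le> 2 ^ card ?P" using card_mono[OF _ sub] fin by (simp add: card_Pow)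
  show "finite (aux_index G)" unfolding aux_index_def using fin finQ by simp
  have "card ?T \<le> Suc (card (Node ` ?P \<union> Quad ` ?Q))"
    using fin finQ by (simp add: card_insert_if card_image)
  also have "\<dots> \<le> Suc (card (Node ` ?P) + card (Quad ` ?Q))"
    using card_Un_le by blast
  also have "\<dots> \<le> Suc (card ?P + card ?Q)"
    using card_image_le[OF fin(1), of Node] card_image_le[OF finQ, of Quad] by linarith
  also have "\<dots> \<le> 3 * 2 ^ card ?P"
    using Q less_exp[of "card ?P"] one_le_power[of "2::nat" "card ?P"] by linarith
  finally have "card ?T \<le> 3 * 2 ^ card ?P" .
  then have "card (aux_index G) \<le> 2 ^ card (nodes G - ?P) * (3 * 2 ^ card ?P)"
    unfolding aux_index_def card_cartesian_product card_Pow[OF fin(2)] by (rule mult_le_mono2)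
  then show "card (aux_index G) \<le> 3 * 2 ^ card (nodes G)"
    using fin(5) by (simp add: mult_ac)
qed

text \<open>In multiples of \<open>2 ^ card (nodes G)\<close>: 2 for the total mass, 1 each for
  \<open>Diag\<close>, \<open>Nonneg\<close> and \<open>Lower\<close>, 2 for \<open>Upper\<close>
  (two ends per edge), and 2 for each of the link families.\<close>

lemma card_ineq_set:
  assumes "is_loop_graph G"
  shows "finite (ineq_set G)" "card (ineq_set G) \<le> 11 * 2 ^ card (nodes G)"
proof -
  note fin = plus_nodes_finite[OF assms]
  let ?P = "plus_nodes G" and ?E = "plus_edges G" and ?M = "Pow (nodes G - plus_nodes G)"
  have finM: "finite ?M" using fin by simp
  have cardM: "card ?M = 2 ^ card (nodes G - ?P)" using fin by (simp add: card_Pow)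
  have e2: "finite e \<and> card e = 2" if "e \<in> ?E" for e
  proof -
    have "e \<in> edges G" using that by (simp add: plus_edges_def)
    from edge_doubleton[OF assms this] show ?thesis by fastforce
  qed
  have finS: "finite (SIGMA e:?E. e)" using fin e2 by auto
  have cardS: "card (SIGMA e:?E. e) = 2 * card ?E"
    using fin e2 by (simp add: card_SigmaI)
  note coords = finite_coords[OF assms]
  show "finite (ineq_set G)"
    unfolding ineq_set_def using fin finM finS coords by (simp del: finite_SigmaI2)
  have img: "card (f ` (?M \<times> B)) \<le> c * 2 ^ card (nodes G)" if "finite B" "card B \<le> c * 2 ^ card ?P"
    for f :: "_ \<Rightarrow> 'a ineq_index" and B :: "'b set" and c
  proof -
    have "card (f ` (?M \<times> B)) \<le> card ?M * card B"
      using card_image_le[of "?M \<times> B" f] finM that(1) by (simp add: card_cartesian_product)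
    also have "\<dots> \<le> 2 ^ card (nodes G - ?P) * (c * 2 ^ card ?P)"
      unfolding cardM using that(2) by (rule mult_le_mono2)
    finally show ?thesis using fin(5) by (simp add: mult_ac)
  qed
  have A: "card ((\<lambda>(S, i). Diag S i) ` (?M \<times> ?P)) \<le> 1 * 2 ^ card (nodes G)"
    using fin less_exp[of "card ?P"] by (intro img) auto
  have B: "card ((\<lambda>(S, e). Nonneg S e) ` (?M \<times> ?E)) \<le> 1 * 2 ^ card (nodes G)"
    using fin by (intro img) auto
  have C: "card ((\<lambda>(S, e). Lower S e) ` (?M \<times> ?E)) \<le> 1 * 2 ^ card (nodes G)"
    using fin by (intro img) auto
  have D: "card ((\<lambda>(S, e, i). Upper S e i) ` (?M \<times> (SIGMA e:?E. e))) \<le> 2 * 2 ^ card (nodes G)"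
    using fin(4) finS by (intro img) (auto simp: cardS)
  have L: "card (f ` (coords G - X)) \<le> 2 * 2 ^ card (nodes G)" for f :: "_ \<Rightarrow> 'a ineq_index" and X
    using card_image_le[of "coords G - X" f] card_mono[of "coords G" "coords G - X"] coords by auto
  have M: "card {Mass_le, Mass_ge :: 'a ineq_index} \<le> 2 * 2 ^ card (nodes G)"
  proof -
    have "card {Mass_le, Mass_ge :: 'a ineq_index} \<le> 2" by (simp add: card_insert_if)
    then show ?thesis using one_le_power[of "2::nat" "card (nodes G)"] by linarith
  qed
  have "card (ineq_set G) \<le> card {Mass_le, Mass_ge :: 'a ineq_index} +
      card ((\<lambda>(S, i). Diag S i) ` (?M \<times> ?P)) +
      card ((\<lambda>(S, e). Nonneg S e) ` (?M \<times> ?E)) +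
      card ((\<lambda>(S, e). Lower S e) ` (?M \<times> ?E)) +
      card ((\<lambda>(S, e, i). Upper S e i) ` (?M \<times> (SIGMA e:?E. e))) +
      card (Link_le ` (coords G - Quad ` plus_loops G)) +
      card (Link_ge ` (coords G - Quad ` minus_loops G))"
    unfolding ineq_set_def by (intro order_trans[OF card_Un_le] add_mono order_refl)
  with A B C D M L[of Link_le "Quad ` plus_loops G"] L[of Link_ge "Quad ` minus_loops G"]
  show "card (ineq_set G) \<le> 11 * 2 ^ card (nodes G)"
    by linarith
qed

section \<open>Linearity of the lifted constraints\<close>

lemma linear_on_moments:
  assumes "finite X" "Inr ` aux_index G \<subseteq> X" "S \<subseteq> nodes G - plus_nodes G"
  shows "linear_on X (\<lambda>w. mass w S)"
    "i \<in> plus_nodes G \<Longrightarrow> linear_on X (\<lambda>w. first_moment w S i)"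
    "i \<in> plus_nodes G \<Longrightarrow> j \<in> plus_nodes G \<Longrightarrow> linear_on X (\<lambda>w. second_moment w S {i, j})"
proof -
  have "Inr (S, None) \<in> X"
    "i \<in> plus_nodes G \<Longrightarrow> Inr (S, Some (Node i)) \<in> X"
    using assms(3) by (auto intro!: subsetD[OF assms(2)] simp: aux_index_def)
  moreover have "Inr (S, Some (Quad {i, j})) \<in> X" if "i \<in> plus_nodes G" "j \<in> plus_nodes G"
  proof -
    have "{i, j} \<in> {{i, j} | i j. i \<in> plus_nodes G \<and> j \<in> plus_nodes G}"
      using that by blast
    with assms(3) show ?thesis
      unfolding aux_index_def
      by (intro subsetD[OF assms(2)[unfolded aux_index_def]] imageI SigmaI insertI2 UnI2) auto
  qed
  ultimately show "linear_on X (\<lambda>w. mass w S)"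
    "i \<in> plus_nodes G \<Longrightarrow> linear_on X (\<lambda>w. first_moment w S i)"
    "i \<in> plus_nodes G \<Longrightarrow> j \<in> plus_nodes G \<Longrightarrow> linear_on X (\<lambda>w. second_moment w S {i, j})"
    unfolding mass_def first_moment_def second_moment_def
    by (auto intro: linear_on_var[OF assms(1)])
qed

lemma coords_cases:
  assumes "is_loop_graph G" "k \<in> coords G"
  obtains (node) i where "k = Node i" "i \<in> nodes G"
    | (edge) i j where "k = Quad {i, j}" "{i, j} \<in> edges G" "i \<noteq> j" "i \<in> nodes G" "j \<in> nodes G"
    | (loop) i where "k = Quad {i}" "{i} \<in> loops G" "i \<in> nodes G"
proof (cases k)
  case (Node i)
  then show ?thesis using assms(2) node by (auto simp: coords_def)
next
  case (Quad e)
  then consider "e \<in> edges G" | "e \<in> loops G"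
    using assms(2) by (auto simp: coords_def)
  then show ?thesis
  proof cases
    case 1
    from edge_doubleton[OF assms(1) this] obtain i j where
      "e = {i, j}" "i \<noteq> j" "i \<in> nodes G" "j \<in> nodes G" .
    then show ?thesis using edge Quad 1 by blast
  next
    case 2
    then obtain i where "e = {i, i}" "i \<in> nodes G"
      using assms(1) unfolding is_loop_graph_def by blast
    then show ?thesis using loop Quad 2 by simp
  qed
qed

lemma moment_coord_Node:
  "moment_coord G S l x W (Node i) = (if i \<in> plus_nodes G then x i else if i \<in> S then l else 0)"
  by (simp add: moment_coord_def)

lemma moment_coord_loop:
  "moment_coord G S l x W (Quad {i}) = (if i \<in> plus_nodes G then W {i} else if i \<in> S then l else 0)"
  by (auto simp: moment_coord_def)

lemma moment_coord_edge:
  assumes "i \<noteq> j"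
  shows "moment_coord G S l x W (Quad {i, j}) =
    (if i \<in> plus_nodes G then (if j \<in> plus_nodes G then W {i, j} else if j \<in> S then x i else 0)
     else if j \<in> plus_nodes G then (if i \<in> S then x j else 0)
     else if {i, j} \<subseteq> S then l else 0)"
  using assms by (auto simp: moment_coord_def Int_insert_left insert_Diff_if)

lemma linear_on_moment_coord:
  assumes G: "is_loop_graph G" and X: "finite X" "Inr ` aux_index G \<subseteq> X"
    and S: "S \<subseteq> nodes G - plus_nodes G" and k: "k \<in> coords G"
  shows "linear_on X (\<lambda>w. moment_coord G S (mass w S) (first_moment w S) (second_moment w S) k)"
proof -
  note lin = linear_on_moments[OF X S] linear_on_zero
  show ?thesis
    using G k
  proof (cases rule: coords_cases)
    case (node i)
    then show ?thesis unfolding node moment_coord_Node by (intro linear_on_if lin)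
  next
    case (edge i j)
    then show ?thesis unfolding edge moment_coord_edge[OF edge(3)] by (intro linear_on_if lin)
  next
    case (loop i)
    then show ?thesis using lin(3)[of i i] unfolding loop moment_coord_loop by (intro linear_on_if lin) simp_all
  qed
qed

lemma linear_on_ineq_lhs:
  assumes G: "is_loop_graph G" and c: "c \<in> ineq_set G"
  shows "linear_on (coords G <+> aux_index G) (ineq_lhs G c)"
proof -
  let ?X = "coords G <+> aux_index G"
  have X: "finite ?X" "Inr ` aux_index G \<subseteq> ?X"
    using finite_coords[OF G] card_aux_index[OF G] by auto
  note lin = linear_on_moments[OF X] linear_on_moment_coord[OF G X] linear_on_add
    linear_on_uminus linear_on_diff linear_on_sum
  have var: "linear_on ?X (\<lambda>w. w (Inl k))" if "k \<in> coords G" for k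
    using that by (intro linear_on_var[OF X(1)]) auto
  have edge: "(\<forall>S. S \<subseteq> nodes G - plus_nodes G \<longrightarrow> linear_on ?X (\<lambda>w. second_moment w S e)) \<and> e \<subseteq> plus_nodes G"
    if "e \<in> plus_edges G" for e
  proof -
    have e: "e \<in> edges G" "e \<subseteq> plus_nodes G" using that by (simp_all add: plus_edges_def)
    from edge_doubleton[OF G e(1)] obtain i j where "e = {i, j}" by blast
    with e(2) show ?thesis using lin(3) by auto
  qed
  show ?thesis
  proof (cases c)
    case Mass_le
    then show ?thesis unfolding Mass_le ineq_lhs.simps by (intro lin) auto
  next
    case Mass_ge
    then show ?thesis unfolding Mass_ge ineq_lhs.simps by (intro lin) auto
  next
    case (Diag S i)
    with c have "S \<subseteq> nodes G - plus_nodes G" "i \<in> plus_nodes G" by (auto simp: ineq_set_def)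
    with lin(3)[of S i i] show ?thesis unfolding Diag ineq_lhs.simps by (intro lin) auto
  next
    case (Nonneg S e)
    with c have "S \<subseteq> nodes G - plus_nodes G" "e \<in> plus_edges G" by (auto simp: ineq_set_def)
    with edge show ?thesis unfolding Nonneg ineq_lhs.simps by (intro lin) auto
  next
    case (Lower S e)
    with c have "S \<subseteq> nodes G - plus_nodes G" "e \<in> plus_edges G" by (auto simp: ineq_set_def)
    with edge[of e] show ?thesis unfolding Lower ineq_lhs.simps
      by (intro linear_on_diff linear_on_sum lin(1,2)) auto
  next
    case (Upper S e i)
    with c have "S \<subseteq> nodes G - plus_nodes G" "e \<in> plus_edges G" "i \<in> e" by (auto simp: ineq_set_def)
    with edge[of e] show ?thesis unfolding Upper ineq_lhs.simps
      by (intro linear_on_diff lin(2)) auto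
  next
    case (Link_le k)
    with c have "k \<in> coords G" by (auto simp: ineq_set_def)
    then show ?thesis unfolding Link_le ineq_lhs.simps
      by (intro linear_on_diff linear_on_sum var lin(4)) auto
  next
    case (Link_ge k)
    with c have "k \<in> coords G" by (auto simp: ineq_set_def)
    then show ?thesis unfolding Link_ge ineq_lhs.simps
      by (intro linear_on_diff linear_on_sum var lin(4)) auto
  qed
qed

lemma linear_on_moment_matrix:
  assumes G: "is_loop_graph G" and S: "S \<in> Pow (nodes G - plus_nodes G)"
    and pq: "p \<in> insert None (Some ` plus_nodes G)" "q \<in> insert None (Some ` plus_nodes G)"
  shows "linear_on (coords G <+> aux_index G)
    (\<lambda>w. moment_matrix (mass w S) (first_moment w S) (second_moment w S) p q)"
proof -
  let ?X = "coords G <+> aux_index G"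
  have X: "finite ?X" "Inr ` aux_index G \<subseteq> ?X"
    using finite_coords[OF G] card_aux_index[OF G] by auto
  have S': "S \<subseteq> nodes G - plus_nodes G" using S by simp
  show ?thesis
    using pq by (auto simp: moment_matrix_def linear_on_moments[OF X S'])
qed

text \<open>The constants are 5 = 2 + 3, from original and auxiliary variables, and 12 = 11 + 1,
  where the last term counts one matrix inequality for each \<open>S\<close>.\<close>

lemma lifted_set_formulation:
  assumes G: "is_loop_graph G"
  shows "\<exists>F. sdp_formulation (coords G) F (lifted_set G) \<and>
    num_variables (coords G) F \<le> 5 * 2 ^ card (nodes G) \<and>
    num_inequalities F \<le> 12 * 2 ^ card (nodes G)"
proof -
  note fin = plus_nodes_finite[OF G]
  have sym: "(\<lambda>w. moment_matrix (mass w S) (first_moment w S) (second_moment w S) p q) =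
      (\<lambda>w. moment_matrix (mass w S) (first_moment w S) (second_moment w S) q p)"
    for S :: "'a set" and p q
    by (auto simp: moment_matrix_def insert_commute split: option.split)
  have "\<exists>F. sdp_formulation (coords G) F (lifted_set G) \<and>
      num_variables (coords G) F = card (coords G) + card (aux_index G) \<and>
      num_inequalities F = card (ineq_set G) + card (Pow (nodes G - plus_nodes G))"
  proof (rule sdp_formulation_feasible_set)
    show "linear_on (coords G <+> aux_index G) (ineq_lhs G c)" if "c \<in> ineq_set G" for c
      by (rule linear_on_ineq_lhs[OF G that])
    show "linear_on (coords G <+> aux_index G)
        (\<lambda>w. moment_matrix (mass w S) (first_moment w S) (second_moment w S) p q)"
      if "S \<in> Pow (nodes G - plus_nodes G)" "p \<in> insert None (Some ` plus_nodes G)"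
        "q \<in> insert None (Some ` plus_nodes G)" for S p q
      by (rule linear_on_moment_matrix[OF G that])
  qed (use fin finite_coords[OF G] card_aux_index[OF G] card_ineq_set[OF G] sym in simp_all)
  then obtain F where F: "sdp_formulation (coords G) F (lifted_set G)"
    "num_variables (coords G) F = card (coords G) + card (aux_index G)"
    "num_inequalities F = card (ineq_set G) + card (Pow (nodes G - plus_nodes G))"
    by blast
  have "card (Pow (nodes G - plus_nodes G)) \<le> 2 ^ card (nodes G)"
    using fin G by (auto simp: card_Pow is_loop_graph_def intro: card_mono)
  with F finite_coords(2)[OF G] card_aux_index(2)[OF G] card_ineq_set(2)[OF G]
  show ?thesis by (intro exI[of _ F]) linarith
qed

text \<open>The case distinction makes \<open>pair_product y {i, j} = y i * y j\<close> hold for \<open>i = j\<close> as well.\<close>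

definition pair_product :: "('a \<Rightarrow> real) \<Rightarrow> 'a set \<Rightarrow> real" where
  "pair_product y e = (if is_singleton e then (y (the_elem e))\<^sup>2 else (\<Prod>i\<in>e. y i))"

lemma pair_product_doubleton: "pair_product y {i, j} = y i * y j"
  by (cases "i = j") (auto simp: pair_product_def power2_eq_square is_singleton_def)

lemma pair_product_singleton: "pair_product y {i} = (y i)\<^sup>2"
  by (simp add: pair_product_def)

section \<open>Every point of \<open>QP G\<close> lies in the lifted set\<close>

definition QP_generators :: "'a loop_graph \<Rightarrow> ('a coord \<Rightarrow>\<^sub>0 real) set" where
  "QP_generators G = {z \<in> vectors_on (coords G).
     (\<forall>i. {i} \<in> plus_loops G \<longrightarrow>
       (Poly_Mapping.lookup z (Node i))\<^sup>2 \<le> Poly_Mapping.lookup z (Quad {i})) \<and>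
     (\<forall>i. {i} \<in> minus_loops G \<longrightarrow>
       Poly_Mapping.lookup z (Quad {i}) \<le> (Poly_Mapping.lookup z (Node i))\<^sup>2) \<and>
     (\<forall>i j. {i, j} \<in> edges G \<longrightarrow>
       Poly_Mapping.lookup z (Quad {i, j}) =
       Poly_Mapping.lookup z (Node i) * Poly_Mapping.lookup z (Node j)) \<and>
     (\<forall>i\<in>nodes G. Poly_Mapping.lookup z (Node i) \<in> {0..1})}"

lemma QP_eq_hull: "QP G = convex hull QP_generators G"
  by (simp add: QP_def QP_generators_def)

text \<open>The matrix is \<open>l\<close> times the outer product of the vector
  \<open>(1, y)\<close> with itself, so its form is \<open>l\<close> times a square.\<close>

lemma psd_on_rank_one:
  assumes "0 \<le> l"
  shows "psd_on (insert None (Some ` P)) (moment_matrix l (\<lambda>i. l * y i) (\<lambda>e. l * pair_product y e))"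
  unfolding psd_on_def
proof
  fix v :: "'a option \<Rightarrow> real"
  let ?R = "insert None (Some ` P)"
  define f where "f p = (case p of None \<Rightarrow> 1 | Some i \<Rightarrow> y i)" for p
  have "moment_matrix l (\<lambda>i. l * y i) (\<lambda>e. l * pair_product y e) p q = l * (f p * f q)" for p q
    by (auto simp: moment_matrix_def f_def pair_product_doubleton split: option.split)
  then have "(\<Sum>p\<in>?R. \<Sum>q\<in>?R. v p * v q * moment_matrix l (\<lambda>i. l * y i) (\<lambda>e. l * pair_product y e) p q) =
      l * (\<Sum>p\<in>?R. v p * f p)\<^sup>2"
    by (simp only: power2_eq_square sum_product) (simp add: sum_distrib_left mult_ac)
  with assms show "0 \<le> (\<Sum>p\<in>?R. \<Sum>q\<in>?R. v p * v q *
      moment_matrix l (\<lambda>i. l * y i) (\<lambda>e. l * pair_product y e) p q)"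
    by simp
qed

lemma minus_node:
  assumes "is_loop_graph G" "{i} \<in> minus_loops G"
  shows "i \<in> nodes G" "i \<notin> plus_nodes G" "{i} \<notin> plus_loops G"
  using assms by (auto simp: is_loop_graph_def plus_nodes_def loops_def doubleton_eq_iff)

lemma plus_node:
  assumes "is_loop_graph G" "{i} \<in> plus_loops G"
  shows "i \<in> nodes G" "i \<in> plus_nodes G" "{i} \<notin> minus_loops G"
  using assms by (auto simp: is_loop_graph_def plus_nodes_def loops_def doubleton_eq_iff)

text \<open>Nodes outside \<open>V\<^sup>+\<close> are rounded independently to 0 or 1 with mean
  \<open>y i\<close>, the others keep their value. Independence preserves the product on every edge,
  since its ends are distinct.\<close>

lemma lifted_point_product:
  assumes G: "is_loop_graph G" and z: "z \<in> QP_generators G"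
  defines "y \<equiv> \<lambda>i. Poly_Mapping.lookup z (Node i)"
  defines "l \<equiv> product_weight y (nodes G - plus_nodes G)"
  shows "lifted_point G (Poly_Mapping.lookup z) l (\<lambda>S i. l S * y i) (\<lambda>S e. l S * pair_product y e)"
proof -
  let ?P = "plus_nodes G" and ?M = "nodes G - plus_nodes G"
  have finM: "finite ?M" using plus_nodes_finite[OF G] by simp
  have y01: "0 \<le> y i" "y i \<le> 1" if "i \<in> nodes G" for i
    using z that by (auto simp: QP_generators_def y_def)
  have PV: "i \<in> nodes G" if "i \<in> ?P" for i
    using that by (simp add: plus_nodes_def)
  have l0: "0 \<le> l S" if "S \<in> Pow ?M" for S
    unfolding l_def using that y01 by (intro product_weight_nonneg) auto
  have total: "(\<Sum>S\<in>Pow ?M. l S) = 1"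
    unfolding l_def by (rule sum_product_weight[OF finM])
  have total': "(\<Sum>S\<in>Pow ?M. l S * c) = c" for c
    by (simp add: sum_distrib_right[symmetric] total)
  have one: "(\<Sum>S\<in>Pow ?M. if i \<in> S then l S * c else 0) = y i * c" if "i \<in> ?M" for i c
  proof -
    have "(\<Sum>S\<in>Pow ?M. if i \<in> S then l S * c else 0) =
        (\<Sum>S\<in>Pow ?M. if {i} \<subseteq> S then product_weight y ?M S else 0) * c"
      unfolding sum_distrib_right l_def by (intro sum.cong) auto
    then show ?thesis
      using sum_product_weight_superset[OF finM, of "{i}" y] that by simp
  qed
  have one': "(\<Sum>S\<in>Pow ?M. if i \<in> S then l S else 0) = y i" if "i \<in> ?M" for i
    using one[OF that, of 1] unfolding mult_1_right .
  have two: "(\<Sum>S\<in>Pow ?M. if {i, j} \<subseteq> S then l S else 0) = y i * y j" if "i \<in> ?M" "j \<in> ?M" "i \<noteq> j" for i j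
    unfolding l_def using sum_product_weight_superset[OF finM, of "{i, j}" y] that by simp
  let ?s = "\<lambda>k. \<Sum>S\<in>Pow ?M. moment_coord G S (l S) (\<lambda>i. l S * y i) (\<lambda>e. l S * pair_product y e) k"
  have s_node: "?s (Node i) = y i" if "i \<in> nodes G" for i
    using that one'[of i] total' by (cases "i \<in> ?P") (simp_all add: moment_coord_Node)
  have s_edge: "?s (Quad {i, j}) = y i * y j" if "i \<in> nodes G" "j \<in> nodes G" "i \<noteq> j" for i j
    using that one[of i "y j"] one[of j "y i"] two[of i j] total'
    by (cases "i \<in> ?P"; cases "j \<in> ?P")
      (simp_all add: moment_coord_edge pair_product_doubleton mult.commute[of "y j" "y i"])
  \<comment> \<open>Rounding raises the second moment outside \<open>V\<^sup>+\<close> from the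
    square of \<open>y i\<close> to \<open>y i\<close>, which the upper bound at a minus loop
    tolerates.\<close>
  have s_loop: "?s (Quad {i}) = (if i \<in> ?P then (y i)\<^sup>2 else y i)" if "i \<in> nodes G" for i
    using that one'[of i] total'
    by (cases "i \<in> ?P") (simp_all add: moment_coord_loop pair_product_singleton)
  have upper: "Poly_Mapping.lookup z k \<le> ?s k" if k: "k \<in> coords G - Quad ` plus_loops G" for k
  proof -
    from k have "k \<in> coords G" by simp
    with G show ?thesis
    proof (cases rule: coords_cases)
      case (node i)
      then show ?thesis using s_node by (simp add: y_def)
    next
      case (edge i j)
      then show ?thesis using s_edge z
        by (simp add: y_def QP_generators_def)
    next
      case (loop i)
      then have i: "{i} \<in> minus_loops G" using k by (auto simp: loops_def)
      then have "Poly_Mapping.lookup z k \<le> (y i)\<^sup>2"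
        using z loop(1) by (simp add: QP_generators_def y_def)
      also have "\<dots> \<le> y i"
        using y01[OF loop(3)] by (simp add: power2_eq_square mult_left_le)
      finally show ?thesis
        using minus_node[OF G i] s_loop loop
        by simp
    qed
  qed
  have lower: "?s k \<le> Poly_Mapping.lookup z k" if k: "k \<in> coords G - Quad ` minus_loops G" for k
  proof -
    from k have "k \<in> coords G" by simp
    with G show ?thesis
    proof (cases rule: coords_cases)
      case (node i)
      then show ?thesis using s_node by (simp add: y_def)
    next
      case (edge i j)
      then show ?thesis using s_edge z
        by (simp add: y_def QP_generators_def)
    next
      case (loop i)
      then have i: "{i} \<in> plus_loops G" using k by (auto simp: loops_def)
      then have "(y i)\<^sup>2 \<le> Poly_Mapping.lookup z k"
        using z loop(1) by (simp add: QP_generators_def y_def)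
      then show ?thesis
        using plus_node[OF G i] s_loop loop
        by simp
    qed
  qed
  have diag: "l S * pair_product y {i} \<le> l S * y i" if "S \<in> Pow ?M" "i \<in> ?P" for S i
    using l0[OF that(1)] y01[OF PV[OF that(2)]]
    by (simp add: pair_product_singleton power2_eq_square mult_left_le mult_left_mono)
  have mc: "0 \<le> l S * pair_product y e \<and> (\<Sum>i\<in>e. l S * y i) - l S \<le> l S * pair_product y e \<and>
      (\<forall>i\<in>e. l S * pair_product y e \<le> l S * y i)" if S: "S \<in> Pow ?M" and e: "e \<in> plus_edges G" for S e
  proof -
    have e': "e \<in> edges G" using e by (simp add: plus_edges_def)
    from edge_doubleton[OF G e'] obtain i j where
      ij: "e = {i, j}" "i \<noteq> j" "i \<in> nodes G" "j \<in> nodes G" .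
    \<comment> \<open>Expanded, this is the lower McCormick inequality.\<close>
    have "0 \<le> (1 - y i) * (1 - y j)" using y01 ij by simp
    then have "y i + y j - 1 \<le> y i * y j" by (simp add: algebra_simps)
    then have "l S * (y i + y j - 1) \<le> l S * (y i * y j)" using l0[OF S] by (rule mult_left_mono)
    moreover have "y i * y j \<le> y i" "y i * y j \<le> y j"
      using y01 ij by (simp_all add: mult_left_le mult_left_le_one_le)
    then have "l S * (y i * y j) \<le> l S * y i" "l S * (y i * y j) \<le> l S * y j"
      using l0[OF S] by (auto intro: mult_left_mono)
    moreover have "0 \<le> l S * (y i * y j)" using l0[OF S] y01 ij by simp
    ultimately show ?thesis
      using ij by (simp add: pair_product_doubleton algebra_simps)
  qed
  show ?thesis
    unfolding lifted_point_def
    by (intro conjI ballI total upper lower psd_on_rank_one l0 diag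
        mc[THEN conjunct1] mc[THEN conjunct2, THEN conjunct1]
        mc[THEN conjunct2, THEN conjunct2, THEN bspec])
qed

lemma QP_subset_lifted_set:
  assumes G: "is_loop_graph G"
  shows "QP G \<subseteq> lifted_set G"
  unfolding QP_eq_hull
proof (rule hull_minimal)
  show "QP_generators G \<subseteq> lifted_set G"
  proof
    fix z assume z: "z \<in> QP_generators G"
    then have "z \<in> vectors_on (coords G)" by (simp add: QP_generators_def)
    with lifted_point_product[OF G z] show "z \<in> lifted_set G"
      unfolding mem_lifted_set_iff by blast
  qed
  show "convex (lifted_set G)"
    by (rule convex_feasible_set) (use linear_on_ineq_lhs[OF G] linear_on_moment_matrix[OF G] in auto)
qed

section \<open>Every point of the lifted set lies in \<open>QP G\<close>\<close>

lemma poly_mapping_of_finite_support: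
  assumes "finite K"
  obtains z :: "'k \<Rightarrow>\<^sub>0 real" where
    "z \<in> vectors_on K" "\<And>k. k \<in> K \<Longrightarrow> Poly_Mapping.lookup z k = f k"
proof -
  have "finite {k. (if k \<in> K then f k else 0) \<noteq> 0}"
    by (rule finite_subset[OF _ assms]) auto
  then have "Poly_Mapping.lookup (Poly_Mapping.Abs_poly_mapping (\<lambda>k. if k \<in> K then f k else 0)) =
      (\<lambda>k. if k \<in> K then f k else 0)"
    by (rule Poly_Mapping.lookup_Abs_poly_mapping)
  then show ?thesis
    using that[of "Poly_Mapping.Abs_poly_mapping (\<lambda>k. if k \<in> K then f k else 0)"]
    by (simp add: vectors_on_iff)
qed

text \<open>The coordinates belonging to node values \<open>y\<close> when all loop constraints are
  tight.\<close>

definition product_coord :: "('a \<Rightarrow> real) \<Rightarrow> 'a coord \<Rightarrow> real" where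
  "product_coord y k = (case k of Node i \<Rightarrow> y i | Quad e \<Rightarrow> pair_product y e)"

text \<open>For each \<open>S\<close> the moments on \<open>V\<^sup>+\<close> are realised by a
  distribution over the sets \<open>D\<close> of matching edges. Pairs \<open>(S, D)\<close> with
  weight \<open>l S * m S D\<close> then express \<open>z\<close> as a convex combination of
  generators.\<close>

lemma lifted_set_subset_QP:
  assumes G: "is_loop_graph G" "no_connected_plus_triplets G"
  shows "lifted_set G \<subseteq> QP G"
proof
  fix z assume "z \<in> lifted_set G"
  then obtain l x W where z: "z \<in> vectors_on (coords G)"
    and lp: "lifted_point G (Poly_Mapping.lookup z) l x W"
    unfolding mem_lifted_set_iff by blast
  let ?P = "plus_nodes G" and ?M = "nodes G - plus_nodes G" and ?E = "plus_edges G"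
  have fin: "finite ?P" "finite ?M" "finite ?E" using plus_nodes_finite[OF G(1)] by simp_all
  have E: "e \<subseteq> ?P \<and> card e = 2" if "e \<in> ?E" for e
  proof -
    have "e \<in> edges G" "e \<subseteq> ?P" using that by (simp_all add: plus_edges_def)
    then show ?thesis using edge_doubleton[OF G(1)] by (metis card_2_iff)
  qed
  have total: "(\<Sum>S\<in>Pow ?M. l S) = 1"
    using lp unfolding lifted_point_def by blast
  have S: "psd_on (insert None (Some ` ?P)) (moment_matrix (l S) (x S) (W S))"
    "\<And>i. i \<in> ?P \<Longrightarrow> W S {i} \<le> x S i"
    "\<And>i j. {i, j} \<in> ?E \<Longrightarrow> 0 \<le> W S {i, j} \<and> x S i + x S j - l S \<le> W S {i, j} \<and> W S {i, j} \<le> x S i"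
    if "S \<in> Pow ?M" for S
  proof -
    show "psd_on (insert None (Some ` ?P)) (moment_matrix (l S) (x S) (W S))"
      "\<And>i. i \<in> ?P \<Longrightarrow> W S {i} \<le> x S i"
      using lp that unfolding lifted_point_def by blast+
    fix i j assume e: "{i, j} \<in> ?E"
    then have "i \<noteq> j" using E by fastforce
    moreover have "0 \<le> W S {i, j} \<and> (\<Sum>i\<in>{i, j}. x S i) - l S \<le> W S {i, j} \<and> W S {i, j} \<le> x S i"
      using lp that e unfolding lifted_point_def by blast
    ultimately show "0 \<le> W S {i, j} \<and> x S i + x S j - l S \<le> W S {i, j} \<and> W S {i, j} \<le> x S i"
      by simp
  qed
  have l0: "0 \<le> l S" if "S \<in> Pow ?M" for S
    using scaled_matching_moments[OF fin(1) E plus_edges_matching[OF G] S[OF that]] by blast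
  have "\<forall>S\<in>Pow ?M. \<exists>r. case r of (m, y) \<Rightarrow> (\<forall>D\<in>Pow ?E. 0 \<le> m D) \<and> sum m (Pow ?E) = 1 \<and>
    (\<forall>i\<in>?P. (\<forall>D. y D i \<in> {0..1}) \<and> l S * (\<Sum>D\<in>Pow ?E. m D * y D i) = x S i \<and>
       l S * (\<Sum>D\<in>Pow ?E. m D * (y D i)\<^sup>2) \<le> W S {i}) \<and>
    (\<forall>i j. {i, j} \<in> ?E \<longrightarrow> l S * (\<Sum>D\<in>Pow ?E. m D * (y D i * y D j)) = W S {i, j})"
    unfolding split_paired_Ex prod.case
    using scaled_matching_moments[OF fin(1) E plus_edges_matching[OF G] S] by blast
  then obtain r where r: "\<forall>S\<in>Pow ?M. case r S of (m, y) \<Rightarrow> (\<forall>D\<in>Pow ?E. 0 \<le> m D) \<and> sum m (Pow ?E) = 1 \<and>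
    (\<forall>i\<in>?P. (\<forall>D. y D i \<in> {0..1}) \<and> l S * (\<Sum>D\<in>Pow ?E. m D * y D i) = x S i \<and>
       l S * (\<Sum>D\<in>Pow ?E. m D * (y D i)\<^sup>2) \<le> W S {i}) \<and>
    (\<forall>i j. {i, j} \<in> ?E \<longrightarrow> l S * (\<Sum>D\<in>Pow ?E. m D * (y D i * y D j)) = W S {i, j})"
    by (rule bchoice[THEN exE]) blast
  define m where "m S = fst (r S)" for S
  define y where "y S = snd (r S)" for S
  have m: "\<And>D. D \<in> Pow ?E \<Longrightarrow> 0 \<le> m S D" "sum (m S) (Pow ?E) = 1"
    "\<And>i D. i \<in> ?P \<Longrightarrow> y S D i \<in> {0..1}"
    "\<And>i. i \<in> ?P \<Longrightarrow> l S * (\<Sum>D\<in>Pow ?E. m S D * y S D i) = x S i"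
    "\<And>i. i \<in> ?P \<Longrightarrow> l S * (\<Sum>D\<in>Pow ?E. m S D * (y S D i)\<^sup>2) \<le> W S {i}"
    "\<And>i j. {i, j} \<in> ?E \<Longrightarrow> l S * (\<Sum>D\<in>Pow ?E. m S D * (y S D i * y S D j)) = W S {i, j}"
    if "S \<in> Pow ?M" for S
    using bspec[OF r that] unfolding m_def y_def split_beta by blast+
  \<comment> \<open>The node values of the generator for \<open>(S, D)\<close>: those outside
    \<open>V\<^sup>+\<close> are fixed by \<open>S\<close> alone.\<close>
  define h where "h S D i = (if i \<in> ?P then y S D i else of_bool (i \<in> S))" for S D i
  have h01: "h S D i \<in> {0..1}" if "S \<in> Pow ?M" for S D i
    using m(3)[OF that] by (simp add: h_def)
  let ?c = "\<lambda>S k. moment_coord G S (l S) (x S) (W S) k"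
  \<comment> \<open>\<open>?c\<close> is the contribution of \<open>S\<close> prescribed by the
    lifted variables, \<open>?a\<close> the one realised by the mixture. They agree at nodes, edges
    and loops outside \<open>V\<^sup>+\<close>; at loops in \<open>V\<^sup>+\<close> the realised
    one may be smaller.\<close>
  let ?a = "\<lambda>S k. l S * (\<Sum>D\<in>Pow ?E. m S D * product_coord (h S D) k)"
  have const: "(\<Sum>D\<in>Pow ?E. m S D * c) = c" if "S \<in> Pow ?M" for S c
    unfolding sum_distrib_right[symmetric] m(2)[OF that] by simp
  have a_node: "?a S (Node i) = ?c S (Node i)" if "S \<in> Pow ?M" for S i
    using m(4)[OF that] const[OF that]
    by (cases "i \<in> ?P") (simp_all add: product_coord_def h_def moment_coord_Node)
  \<comment> \<open>An end outside \<open>V\<^sup>+\<close> has a value independent of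
    \<open>D\<close>, so first moments suffice there; an edge with both ends in
    \<open>V\<^sup>+\<close> belongs to the matching.\<close>
  have a_edge: "?a S (Quad {i, j}) = ?c S (Quad {i, j})"
    if S': "S \<in> Pow ?M" and ij: "{i, j} \<in> edges G" "i \<noteq> j" for S i j
  proof -
    have PE: "{i, j} \<in> ?E" if "i \<in> ?P" "j \<in> ?P"
      using ij that by (simp add: plus_edges_def)
    show ?thesis
      using m(6)[OF S' PE] m(4)[OF S'] const[OF S', of 1]
      by (cases "i \<in> ?P"; cases "j \<in> ?P"; cases "i \<in> S"; cases "j \<in> S")
        (simp_all add: product_coord_def pair_product_doubleton h_def moment_coord_edge[OF ij(2)])
  qed
  have a_plus: "?a S (Quad {i}) \<le> ?c S (Quad {i})" if "S \<in> Pow ?M" "i \<in> ?P" for S i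
    using m(5)[OF that] that(2)
    by (simp add: product_coord_def h_def moment_coord_loop pair_product_singleton)
  \<comment> \<open>Outside \<open>V\<^sup>+\<close> the values are 0 and 1, which equal their
    squares.\<close>
  have a_minus: "?a S (Quad {i}) = ?c S (Quad {i})" if "S \<in> Pow ?M" "i \<notin> ?P" for S i
    using const[OF that(1)] that(2)
    by (simp add: product_coord_def h_def moment_coord_loop pair_product_singleton)
  \<comment> \<open>Only loop coordinates have a gap; it is added to every point of the mixture, which the one-sided
    loop constraints allow.\<close>
  define gap where "gap k = Poly_Mapping.lookup z k - (\<Sum>S\<in>Pow ?M. ?a S k)" for k
  have upper: "Poly_Mapping.lookup z k \<le> (\<Sum>S\<in>Pow ?M. ?c S k)" if "k \<in> coords G - Quad ` plus_loops G" for k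
    using lp that unfolding lifted_point_def by blast
  have lower: "(\<Sum>S\<in>Pow ?M. ?c S k) \<le> Poly_Mapping.lookup z k" if "k \<in> coords G - Quad ` minus_loops G" for k
    using lp that unfolding lifted_point_def by blast
  have loops_card: "card e \<noteq> 2" if "e \<in> loops G" for e
    using that G(1) by (auto simp: is_loop_graph_def)
  have gap_node: "gap (Node i) = 0" if "i \<in> nodes G" for i
  proof -
    have "Node i \<in> coords G - Quad ` plus_loops G" "Node i \<in> coords G - Quad ` minus_loops G"
      using that by (auto simp: coords_def)
    from upper[OF this(1)] lower[OF this(2)] show ?thesis
      using a_node by (simp add: gap_def)
  qed
  have gap_edge: "gap (Quad {i, j}) = 0" if "{i, j} \<in> edges G" for i j
  proof -
    have ij: "i \<noteq> j" using edge_doubleton[OF G(1) that] by (metis doubleton_eq_iff)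
    then have "{i, j} \<notin> loops G" using loops_card[of "{i, j}"] by auto
    with that have "Quad {i, j} \<in> coords G - Quad ` plus_loops G" "Quad {i, j} \<in> coords G - Quad ` minus_loops G"
      by (auto simp: coords_def loops_def)
    from upper[OF this(1)] lower[OF this(2)] show ?thesis
      using a_edge[OF _ that ij] by (simp add: gap_def)
  qed
  have gap_plus: "0 \<le> gap (Quad {i})" if "{i} \<in> plus_loops G" for i
  proof -
    note i = plus_node[OF G(1) that]
    have "Quad {i} \<in> coords G - Quad ` minus_loops G"
      using that i by (auto simp: coords_def loops_def)
    from lower[OF this] sum_mono[OF a_plus[OF _ i(2)], of "Pow ?M" "\<lambda>S. S"] show ?thesis
      by (simp add: gap_def)
  qed
  have gap_minus: "gap (Quad {i}) \<le> 0" if "{i} \<in> minus_loops G" for i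
  proof -
    note i = minus_node[OF G(1) that]
    have "Quad {i} \<in> coords G - Quad ` plus_loops G"
      using that i by (auto simp: coords_def loops_def)
    from upper[OF this] show ?thesis
      using a_minus[OF _ i(2)] by (simp add: gap_def)
  qed
  have "\<exists>v. v \<in> vectors_on (coords G) \<and>
    (\<forall>k\<in>coords G. Poly_Mapping.lookup v k = product_coord (h S D) k + gap k)" for S D
    by (rule poly_mapping_of_finite_support[OF finite_coords(1)[OF G(1)],
        of "\<lambda>k. product_coord (h S D) k + gap k"]) blast
  then obtain v where v: "\<And>S D. v S D \<in> vectors_on (coords G)"
    "\<And>S D k. k \<in> coords G \<Longrightarrow> Poly_Mapping.lookup (v S D) k = product_coord (h S D) k + gap k"
    by metis
  have v_node: "Poly_Mapping.lookup (v S D) (Node i) = h S D i" if "i \<in> nodes G" for S D i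
    using that v(2)[of "Node i"] gap_node[OF that] by (simp add: coords_def product_coord_def)
  have v_gen: "v S D \<in> QP_generators G" if S': "S \<in> Pow ?M" for S D
    unfolding QP_generators_def mem_Collect_eq
  proof (intro conjI allI impI ballI v(1))
    fix i assume i: "{i} \<in> plus_loops G"
    then have "Quad {i} \<in> coords G" by (simp add: coords_def loops_def)
    with i show "(Poly_Mapping.lookup (v S D) (Node i))\<^sup>2 \<le> Poly_Mapping.lookup (v S D) (Quad {i})"
      using plus_node[OF G(1) i] gap_plus[OF i]
      by (simp add: v_node v(2) product_coord_def pair_product_singleton)
  next
    fix i assume i: "{i} \<in> minus_loops G"
    then have "Quad {i} \<in> coords G" by (simp add: coords_def loops_def)
    with i show "Poly_Mapping.lookup (v S D) (Quad {i}) \<le> (Poly_Mapping.lookup (v S D) (Node i))\<^sup>2"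
      using minus_node[OF G(1) i] gap_minus[OF i]
      by (simp add: v_node v(2) product_coord_def pair_product_singleton)
  next
    fix i j assume ij: "{i, j} \<in> edges G"
    then have "Quad {i, j} \<in> coords G" by (simp add: coords_def)
    moreover have "i \<in> nodes G" "j \<in> nodes G"
      using edge_doubleton[OF G(1) ij] by (metis doubleton_eq_iff)+
    ultimately show "Poly_Mapping.lookup (v S D) (Quad {i, j}) =
        Poly_Mapping.lookup (v S D) (Node i) * Poly_Mapping.lookup (v S D) (Node j)"
      using gap_edge[OF ij]
      by (simp add: v_node v(2) product_coord_def pair_product_doubleton)
  next
    fix i assume "i \<in> nodes G"
    then show "Poly_Mapping.lookup (v S D) (Node i) \<in> {0..1}"
      using h01[OF S'] by (simp add: v_node)
  qed
  let ?I = "Pow ?M \<times> Pow ?E"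
  let ?w = "\<lambda>(S, D). l S * m S D"
  have w1: "(\<Sum>p\<in>?I. ?w p) = 1"
  proof -
    have "(\<Sum>p\<in>?I. ?w p) = (\<Sum>S\<in>Pow ?M. l S * sum (m S) (Pow ?E))"
      by (simp add: sum.cartesian_product[symmetric] sum_distrib_left)
    also have "\<dots> = (\<Sum>S\<in>Pow ?M. l S)"
      using m(2) by (intro sum.cong) simp_all
    finally show ?thesis using total by simp
  qed
  \<comment> \<open>The gap is the same for all points and the weights sum to 1, so the mixture
    recovers it exactly once.\<close>
  have "z = (\<Sum>p\<in>?I. ?w p *\<^sub>R (case p of (S, D) \<Rightarrow> v S D))"
  proof (rule poly_mapping_eqI)
    fix k
    show "Poly_Mapping.lookup z k = Poly_Mapping.lookup (\<Sum>p\<in>?I. ?w p *\<^sub>R (case p of (S, D) \<Rightarrow> v S D)) k"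
    proof (cases "k \<in> coords G")
      case True
      have "Poly_Mapping.lookup (\<Sum>p\<in>?I. ?w p *\<^sub>R (case p of (S, D) \<Rightarrow> v S D)) k =
          (\<Sum>p\<in>?I. (case p of (S, D) \<Rightarrow> l S * m S D * product_coord (h S D) k) + ?w p * gap k)"
        unfolding lookup_sum lookup_scaleR using True
        by (intro sum.cong) (auto simp: v(2) algebra_simps)
      also have "\<dots> = (\<Sum>p\<in>?I. (case p of (S, D) \<Rightarrow> l S * m S D * product_coord (h S D) k)) + gap k"
        unfolding sum.distrib sum_distrib_right[symmetric] w1 by simp
      also have "(\<Sum>p\<in>?I. (case p of (S, D) \<Rightarrow> l S * m S D * product_coord (h S D) k)) =
          (\<Sum>S\<in>Pow ?M. ?a S k)"
        by (simp add: sum.cartesian_product[symmetric] sum_distrib_left mult.assoc)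
      finally show ?thesis by (simp add: gap_def)
    next
      case False
      then have "Poly_Mapping.lookup z k = 0" "\<And>S D. Poly_Mapping.lookup (v S D) k = 0"
        using z v(1) by (auto simp: vectors_on_iff)
      then show ?thesis
        by (simp add: lookup_sum lookup_scaleR split_beta)
    qed
  qed
  also have "\<dots> \<in> QP G"
  proof (rule convex_sum)
    show "finite ?I" using fin by simp
    show "convex (QP G)" by (simp add: QP_eq_hull)
    show "(\<Sum>p\<in>?I. ?w p) = 1" by (rule w1)
    show "0 \<le> ?w p" if "p \<in> ?I" for p
      using that l0 m(1) by auto
    show "(case p of (S, D) \<Rightarrow> v S D) \<in> QP G" if "p \<in> ?I" for p
      using that v_gen by (auto simp: QP_eq_hull intro: hull_inc)
  qed
  finally show "z \<in> QP G" .
qed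

theorem theorem5:
  shows "\<exists>f :: nat \<Rightarrow> real. f \<in> O(\<lambda>n. 2 ^ n) \<and>
    (\<forall>G :: 'a loop_graph. is_loop_graph G \<and> no_connected_plus_triplets G \<longrightarrow>
      (\<exists>F :: 'a coord sdp_system.
         sdp_formulation (coords G) F (QP G) \<and>
         real (num_variables (coords G) F) \<le> f (card (nodes G)) \<and>
         real (num_inequalities F) \<le> f (card (nodes G))))"
proof (intro exI[of _ "\<lambda>n. 12 * 2 ^ n"] conjI allI impI)
  \<comment> \<open>The constant 12 dominates both bounds, 5 for variables and 12 for
    inequalities.\<close>
  show "(\<lambda>n. 12 * 2 ^ n :: real) \<in> O(\<lambda>n. 2 ^ n)" by simp
  fix G :: "'a loop_graph"
  assume "is_loop_graph G \<and> no_connected_plus_triplets G"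
  then have G: "is_loop_graph G" "no_connected_plus_triplets G" by auto
  have "lifted_set G = QP G"
    using lifted_set_subset_QP[OF G] QP_subset_lifted_set[OF G(1)] by blast
  with lifted_set_formulation[OF G(1)] obtain F where F: "sdp_formulation (coords G) F (QP G)"
    "num_variables (coords G) F \<le> 5 * 2 ^ card (nodes G)"
    "num_inequalities F \<le> 12 * 2 ^ card (nodes G)"
    by metis
  have "num_variables (coords G) F \<le> 12 * 2 ^ card (nodes G)"
    using F(2) by linarith
  then have "real (num_variables (coords G) F) \<le> real (12 * 2 ^ card (nodes G))"
    by (rule of_nat_mono)
  moreover have "real (num_inequalities F) \<le> real (12 * 2 ^ card (nodes G))"
    using F(3) by (rule of_nat_mono)
  ultimately show "\<exists>F :: 'a coord sdp_system. sdp_formulation (coords G) F (QP G) \<and>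
      real (num_variables (coords G) F) \<le> 12 * 2 ^ card (nodes G) \<and>
      real (num_inequalities F) \<le> 12 * 2 ^ card (nodes G)"
    using F(1) by (intro exI[of _ F]) simp
qed

end
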